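(* Let $n\ge1$ and $X=\begin{pmatrix}A&B\\ C&-A^t\end{pmatrix}\in sp(n,\mathbb R)$ (with $n\times n$ real blocks, $B$ and $C$ symmetric). Then for all $x,y\in\mathbb R^n$ $$W_1(d\sigma'(X))(x,y)=\tfrac12i\left(2y(Ax)+y(By)-x(Cx)\right)=-\tfrac12i\begin{pmatrix}x&y\end{pmatrix}JX\begin{pmatrix}x\\ y\end{pmatrix}.$$
   Context: Here $\lambda=1$. For $z,w\in\mathbb C^n$, $zw:=\sum_jz_jw_j$ (bilinear), $z^2=zz$, $|z|^2=z\bar z$. $J=\begin{pmatrix}0&I_n\\-I_n&0\end{pmatrix}$, $U=\begin{pmatrix}I_n&iI_n\\ I_n&-iI_n\end{pmatrix}$. $\mathcal F$ is the Hilbert space of holomorphic functions $f$ on $\mathbb C^n$ with $\int_{\mathbb C^n}|f(z)|^2e^{-|z|^2/2}\,d\mu(z)<\infty$, $d\mu(z)=(2\pi)^{-n}dm(z)$, $dm$ Lebesgue measure. With $e_w(z)=\exp(\bar wz/2)$, the kernel of an operator $A$ on $\mathcal F$ is $k_A(z,w)=(Ae_w)(z)$, and $(Af)(z)=\int k_A(z,w)f(w)e^{-|w|^2/2}d\mu(w)$. $S$ is the group of matrices $k=\begin{pmatrix}P&Q\\ \bar Q&\bar P\end{pmatrix}$ with $PP^*-QQ^*=I_n$, $PQ^t=QP^t$; $g\mapsto UgU^{-1}$ is an isomorphism $Sp(n,\mathbb R)\to S$, and $X\mapsto UXU^{-1}$ the corresponding isomorphism of $sp(n,\mathbb R)$ onto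 the Lie algebra $\mathfrak s$ of $S$. For $k\in S$, the metaplectic operator $\sigma(k)$ on $\mathcal F$ has kernel $$b_k(z,w)=(\operatorname{Det}P)^{-1/2}\exp\left(\tfrac14\left(z(\bar QP^{-1}z)+2(P^{-1}z)\bar w-\bar w(P^{-1}Q\bar w)\right)\right)$$ (principal square root). For $Y\in\mathfrak s$, $d\sigma(Y)$ is the differential of $\sigma$: $(d\sigma(Y)f)(z)=\frac{d}{dt}\big|_{t=0}(\sigma(\exp tY)f)(z)$, with kernel $\frac{d}{dt}\big|_{t=0}b_{\exp(tY)}(z,w)$. The metaplectic representation of $Sp(n,\mathbb R)$ is $\sigma'(g)=\mathcal B^{-1}\sigma(UgU^{-1})\mathcal B$, so that $d\sigma'(X)=\mathcal B^{-1}d\sigma(UXU^{-1})\mathcal B$, where $\mathcal B:L^2(\mathbb R^n)\to\mathcal F$ is the (unitary) Bargmann transform $$(\mathcal B\phi)(z)=\pi^{-n/4}\int_{\mathbb R^n}\exp\left(-\tfrac14z^2+zx-\tfrac12x^2\right)\phi(x)\,dx.$$ For an operator $A$ on $\mathcal F$ (not necessarily bounded or trace class) the complex Weyl symbol is $$W_0(A)(z)=2^n\int_{\mathbb C^n}k_A(z+w,z-w)\exp\left(\tfrac12(-z\bar z-w\bar w+z\bar w-\bar zw)\right)d\mu(w).$$ For an operator $A$ on $L^2(\mathbb R^n)$ the Weyl symbol is $W_1(A)(x,y)=W_0(\mathcal BA\mathcal B^{-1})(x+iy)$. *)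

theory Defs
  imports "HOL-Analysis.Analysis"
begin

section \<open>Block matrices and the symplectic Lie algebra\<close>

text \<open>Matrices of size $2n \times 2n$ are indexed by the sum type \<open>'n + 'n\<close>; \<open>Inl\<close> addresses
  the first and \<open>Inr\<close> the second block of indices.\<close>

definition block_mat ::
  "'a^'n^'n \<Rightarrow> 'a^'n^'n \<Rightarrow> 'a^'n^'n \<Rightarrow> 'a^'n^'n \<Rightarrow> 'a^('n::finite + 'n)^('n + 'n)" where
  "block_mat A B C D = (\<chi> r s. case r of
      Inl i \<Rightarrow> (case s of Inl j \<Rightarrow> A $ i $ j | Inr j \<Rightarrow> B $ i $ j)
    | Inr i \<Rightarrow> (case s of Inl j \<Rightarrow> C $ i $ j | Inr j \<Rightarrow> D $ i $ j))"

definition upper_left :: "'a^('n::finite + 'n)^('n + 'n) \<Rightarrow> 'a^'n^'n" where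
  "upper_left k = (\<chi> i j. k $ Inl i $ Inl j)"

definition upper_right :: "'a^('n::finite + 'n)^('n + 'n) \<Rightarrow> 'a^'n^'n" where
  "upper_right k = (\<chi> i j. k $ Inl i $ Inr j)"

definition join_vec :: "'a^'n \<Rightarrow> 'a^'n \<Rightarrow> 'a^('n::finite + 'n)" where
  "join_vec x y = (\<chi> r. case r of Inl i \<Rightarrow> x $ i | Inr i \<Rightarrow> y $ i)"

definition J_mat :: "real^('n::finite + 'n)^('n + 'n)" where
  "J_mat = block_mat 0 (mat 1) (- mat 1) 0"

definition U_mat :: "complex^('n::finite + 'n)^('n + 'n)" where
  "U_mat = block_mat (mat 1) (mat \<i>) (mat 1) (- mat \<i>)"

definition sp_algebra :: "(real^('n::finite + 'n)^('n + 'n)) set" where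
  "sp_algebra = {X. transpose X ** J_mat + J_mat ** X = 0}"

lemma sum_UNIV_Plus:
  "(\<Sum>r\<in>(UNIV :: ('n::finite + 'n) set). f r) = (\<Sum>i\<in>UNIV. f (Inl i)) + (\<Sum>i\<in>UNIV. f (Inr i))"
  using sum.Plus [of "UNIV :: 'n set" "UNIV :: 'n set" f] by (simp add: o_def)

lemma block_mat_mult:
  fixes A B C D :: "'a::semiring_1^'n::finite^'n"
  shows "block_mat A B C D ** block_mat A' B' C' D' =
    block_mat (A ** A' + B ** C') (A ** B' + B ** D') (C ** A' + D ** C') (C ** B' + D ** D')"
  by (simp add: vec_eq_iff block_mat_def matrix_matrix_mult_def sum_UNIV_Plus split: sum.split)

lemma block_mat_add:
  "block_mat A B C D + block_mat A' B' C' D' = block_mat (A + A') (B + B') (C + C') (D + D')"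
  by (simp add: vec_eq_iff block_mat_def split: sum.split)

lemma transpose_block_mat:
  "transpose (block_mat A B C D) =
    block_mat (transpose A) (transpose C) (transpose B) (transpose D)"
  by (simp add: vec_eq_iff block_mat_def transpose_def split: sum.split)

lemma block_mat_eq_0_iff: "block_mat A B C D = 0 \<longleftrightarrow> A = 0 \<and> B = 0 \<and> C = 0 \<and> D = 0"
proof
  assume zero: "block_mat A B C D = 0"
  have entries: "block_mat A B C D $ r $ s = 0" for r s
    using zero by simp
  show "A = 0 \<and> B = 0 \<and> C = 0 \<and> D = 0"
    using entries [of "Inl _" "Inl _"] entries [of "Inl _" "Inr _"]
      entries [of "Inr _" "Inl _"] entries [of "Inr _" "Inr _"]
    by (simp add: vec_eq_iff block_mat_def)
next
  assume "A = 0 \<and> B = 0 \<and> C = 0 \<and> D = 0"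
  then show "block_mat A B C D = 0"
    by (simp add: vec_eq_iff block_mat_def split: sum.split)
qed

lemma block_mat_in_sp_algebra_iff:
  fixes A B C D :: "real^'n::finite^'n"
  shows "block_mat A B C D \<in> sp_algebra \<longleftrightarrow>
    D = - transpose A \<and> transpose B = B \<and> transpose C = C"
proof -
  have neg: "(- mat 1) ** M = - M" "M ** (- mat 1) = - M" for M :: "real^'n^'n"
    by (simp_all add: vec_eq_iff matrix_matrix_mult_def mat_def if_distrib [of "\<lambda>c. - c"]
        if_distrib [of "\<lambda>c. c * _"] if_distrib [of "\<lambda>c. _ * c"] cong: if_cong)
  have "block_mat A B C D \<in> sp_algebra \<longleftrightarrow>
    - transpose C + C = 0 \<and> transpose A + D = 0 \<and> - transpose D + - A = 0 \<and> transpose B + - B = 0"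
    by (simp add: sp_algebra_def J_mat_def block_mat_mult block_mat_add transpose_block_mat
        block_mat_eq_0_iff neg)
  also have "\<dots> \<longleftrightarrow> D = - transpose A \<and> transpose B = B \<and> transpose C = C"
  proof -
    have neg_transpose: "transpose (- M) = - transpose M" for M :: "real^'n^'n"
      by (simp add: vec_eq_iff transpose_def)
    have "- transpose C + C = 0 \<longleftrightarrow> transpose C = C" "transpose B + - B = 0 \<longleftrightarrow> transpose B = B"
      by (metis add.inverse_inverse add_eq_0_iff)+
    moreover have "transpose A + D = 0 \<longleftrightarrow> D = - transpose A"
      by (rule add_eq_0_iff)
    moreover have "- transpose D + - A = 0" if "D = - transpose A"
      using that by (simp add: neg_transpose)
    ultimately show ?thesis
      by blast
  qed
  finally show ?thesis .
qed

definition mat_exp :: "complex^'m::finite^'m \<Rightarrow> complex^'m^'m" where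
  "mat_exp M = (\<Sum>k. (1 / fact k) *\<^sub>R ((\<lambda>N. M ** N) ^^ k) (mat 1))"

section \<open>Fock space and the metaplectic operators\<close>

definition bil :: "complex^'n::finite \<Rightarrow> complex^'n \<Rightarrow> complex" where
  "bil z w = (\<Sum>j\<in>UNIV. z $ j * w $ j)"

definition cnj_vec :: "complex^'n::finite \<Rightarrow> complex^'n" where
  "cnj_vec z = (\<chi> j. cnj (z $ j))"

definition cvec :: "real^'n::finite \<Rightarrow> complex^'n" where
  "cvec x = (\<chi> j. complex_of_real (x $ j))"

definition mu :: "(complex^'n::finite) measure" where
  "mu = density lborel (\<lambda>_. ennreal (1 / (2 * pi) ^ CARD('n)))"

definition entire_Cn :: "(complex^'n::finite \<Rightarrow> complex) \<Rightarrow> bool" where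
  "entire_Cn f \<longleftrightarrow>
    (\<forall>z. \<exists>f'. (f has_derivative f') (at z) \<and> (\<forall>c v. f' (c *s v) = c * f' v))"

definition fock_space :: "(complex^'n::finite \<Rightarrow> complex) set" where
  "fock_space =
    {f. entire_Cn f \<and> integrable mu (\<lambda>z. (cmod (f z))\<^sup>2 * exp (- (norm z)\<^sup>2 / 2))}"

definition coherent :: "complex^'n::finite \<Rightarrow> complex^'n \<Rightarrow> complex" where
  "coherent w = (\<lambda>z. exp (bil (cnj_vec w) z / 2))"

text \<open>Operators are total functions between function spaces; those given on the Fock space have
  the unspecified value \<open>undefined\<close> off it. Only their values on the functions \<open>coherent w\<close>
  enter the kernel.\<close>

definition op_kernel ::
  "((complex^'n::finite \<Rightarrow> complex) \<Rightarrow> (complex^'n \<Rightarrow> complex)) \<Rightarrow> complex^'n \<Rightarrow> complex^'n \<Rightarrow> complex"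
  where "op_kernel T z w = T (coherent w) z"

text \<open>The lower blocks of \<open>k\<close> do not occur, since on the group $S$ they are the conjugates of
  the upper ones. Below, \<open>k\<close> is always \<open>mat_exp (t *\<^sub>R Y)\<close> with \<open>Y\<close> in the Lie algebra
  of $S$.\<close>

definition metaplectic_kernel ::
  "complex^('n::finite + 'n)^('n + 'n) \<Rightarrow> complex^'n \<Rightarrow> complex^'n \<Rightarrow> complex" where
  "metaplectic_kernel k z w =
    (let P = upper_left k; Q = upper_right k; R = matrix_inv P; wb = cnj_vec w in
      inverse (csqrt (det P)) *
      exp ((bil z ((map_matrix cnj Q ** R) *v z) + 2 * bil (R *v z) wb
            - bil wb ((R ** Q) *v wb)) / 4))"

definition metaplectic ::
  "complex^('n::finite + 'n)^('n + 'n) \<Rightarrow> (complex^'n \<Rightarrow> complex) \<Rightarrow> complex^'n \<Rightarrow> complex" where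
  "metaplectic k = (\<lambda>f\<in>fock_space. \<lambda>z.
    (\<integral>w. metaplectic_kernel k z w * f w * exp (- complex_of_real ((norm w)\<^sup>2) / 2) \<partial>mu))"

definition d_metaplectic ::
  "complex^('n::finite + 'n)^('n + 'n) \<Rightarrow> (complex^'n \<Rightarrow> complex) \<Rightarrow> complex^'n \<Rightarrow> complex" where
  "d_metaplectic Y = (\<lambda>f\<in>fock_space. \<lambda>z.
    vector_derivative (\<lambda>t. metaplectic (mat_exp (t *\<^sub>R Y)) f z) (at 0))"

section \<open>The Bargmann transform\<close>

text \<open>Elements of $L^2$ are represented by Borel functions, without passing to classes modulo
  null sets. The transform does not depend on the representative, so \<open>inv_into\<close> below picks some
  representative of the inverse image.\<close>

definition L2_functions :: "(real^'n::finite \<Rightarrow> complex) set" where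
  "L2_functions =
    {\<phi>. \<phi> \<in> borel_measurable lborel \<and> integrable lborel (\<lambda>x. (cmod (\<phi> x))\<^sup>2)}"

definition bargmann :: "(real^'n::finite \<Rightarrow> complex) \<Rightarrow> complex^'n \<Rightarrow> complex" where
  "bargmann = (\<lambda>\<phi>\<in>L2_functions. \<lambda>z. complex_of_real (pi powr (- real CARD('n) / 4)) *
    (\<integral>x. exp (- bil z z / 4 + bil z (cvec x) - complex_of_real (x \<bullet> x) / 2) * \<phi> x \<partial>lborel))"

definition bargmann_inv :: "(complex^'n::finite \<Rightarrow> complex) \<Rightarrow> real^'n \<Rightarrow> complex" where
  "bargmann_inv = inv_into L2_functions bargmann"

definition d_metaplectic' ::
  "real^('n::finite + 'n)^('n + 'n) \<Rightarrow> (real^'n \<Rightarrow> complex) \<Rightarrow> real^'n \<Rightarrow> complex" where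
  "d_metaplectic' X =
    bargmann_inv \<circ> d_metaplectic (U_mat ** map_matrix complex_of_real X ** matrix_inv U_mat)
      \<circ> bargmann"

section \<open>Weyl symbols\<close>

definition weyl_symbol_fock ::
  "((complex^'n::finite \<Rightarrow> complex) \<Rightarrow> (complex^'n \<Rightarrow> complex)) \<Rightarrow> complex^'n \<Rightarrow> complex" where
  "weyl_symbol_fock T z = 2 ^ CARD('n) *
    (\<integral>w. op_kernel T (z + w) (z - w) *
      exp ((- bil z (cnj_vec z) - bil w (cnj_vec w) + bil z (cnj_vec w) - bil (cnj_vec z) w) / 2)
     \<partial>mu)"

definition weyl_symbol ::
  "((real^'n::finite \<Rightarrow> complex) \<Rightarrow> (real^'n \<Rightarrow> complex)) \<Rightarrow> real^'n \<Rightarrow> real^'n \<Rightarrow> complex" where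
  "weyl_symbol T x y = weyl_symbol_fock (bargmann \<circ> T \<circ> bargmann_inv) (cvec x + \<i> *s cvec y)"

end

theory Submission
  imports Defs "HOL-Probability.Characteristic_Functions" "HOL-Real_Asymp.Real_Asymp"
    "HOL-Complex_Analysis.Cauchy_Integral_Formula"
begin

text \<open>The Fock space reproducing property evaluates \<open>metaplectic k\<close> on \<open>coherent w\<close> as
  \<open>metaplectic_kernel k z w\<close> for \<open>k\<close> near the identity. It follows from translation invariance and the
  mean value property over circles, because the Gaussian weight is invariant under
  \<open>w \<mapsto> cis t *s w\<close>. Differentiating along \<open>mat_exp (t *\<^sub>R Y)\<close>, with \<open>P\<close>, \<open>Q\<close> the upper blocks of
  \<open>Y\<close>, gives the kernel of \<open>d_metaplectic Y\<close>: the exponential \<open>exp (z w / 2)\<close>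
  (with \<open>w\<close> conjugated) times a quadratic polynomial. Such functions of \<open>z\<close> are Bargmann transforms of
  polynomials times Gaussians, so that \<open>bargmann \<circ> bargmann_inv\<close> acts on them as the identity. In the
  Weyl symbol the exponentials combine to the Gaussian \<open>exp (- \<bar>w\<bar>\<^sup>2)\<close>, and the only
  surviving second moment, that of \<open>w\<close> against its conjugate, cancels the constant \<open>- trace P / 2\<close> coming
  from the determinant.\<close>

section \<open>Gaussian integrals\<close>

text \<open>The inverse of the Bargmann transform is an \<open>inv_into\<close>, a right inverse on
  the range only. Hence the coherent states and their images under \<open>d_metaplectic Y\<close>
  both have to be exhibited as transforms. All these functions are polynomials of degree at most two
  times an exponential, so Gaussian moments up to order two settle this question and the Weyl
  integral alike. The other obstacle is that \<open>metaplectic k\<close> is an integral operator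
  and \<open>op_kernel\<close> applies it to \<open>coherent w\<close>. That the result is the
  prescribed kernel is a claim about integrals of exponentials of quadratic forms in the conjugate
  variable, and it is proved here for quadratic parts that are small against the weight. Along
  \<open>mat_exp (t *\<^sub>R Y)\<close> their matrix \<open>matrix_inv P ** Q\<close> vanishes at t
  = 0, so smallness holds for t near 0, which is all that a derivative at 0 sees. Averaging over
  circles treats an arbitrary small form at once, where a coordinatewise evaluation would call for
  diagonalisation.\<close>

lemma has_bochner_integral_lborel_prod:
  fixes f :: "'a::euclidean_space \<Rightarrow> real \<Rightarrow> 'c::{real_normed_field,banach,second_countable_topology}"
  assumes "\<And>b. b \<in> Basis \<Longrightarrow> integrable lborel (f b)"
  shows "has_bochner_integral lborel (\<lambda>x. \<Prod>b\<in>Basis. f b (x \<bullet> b))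
    (\<Prod>b\<in>Basis. integral\<^sup>L lborel (f b))"
proof -
  interpret product_sigma_finite "\<lambda>_. lborel :: real measure"
    by standard
  let ?M = "\<Pi>\<^sub>M b\<in>(Basis :: 'a set). (lborel :: real measure)"
  have [measurable]: "f b \<in> borel_measurable borel" if "b \<in> Basis" for b
    using borel_measurable_integrable [OF assms [OF that]] by simp
  have int: "has_bochner_integral ?M (\<lambda>x. \<Prod>b\<in>Basis. f b (x b)) (\<Prod>b\<in>Basis. integral\<^sup>L lborel (f b))"
    unfolding has_bochner_integral_iff
    by (intro conjI product_integrable_prod product_integral_prod finite_Basis assms)
  have eq: "(\<Prod>b\<in>Basis. f b ((\<Sum>b'\<in>Basis. x b' *\<^sub>R b') \<bullet> b)) = (\<Prod>b\<in>Basis. f b (x b))" for x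
    by (intro prod.cong refl) (simp add: inner_sum_left inner_Basis if_distrib cong: if_cong)
  \<comment> \<open>Lebesgue measure is the image of the product measure under assembling a vector
    from its coordinates; \<open>eq\<close> undoes the assembly.\<close>
  show ?thesis
    by (subst lborel_eq [where 'a = 'a], rule has_bochner_integral_distr) (simp_all add: eq int)
qed

section \<open>Gaussian integrals on the real line\<close>

lemma integrable_exp_quadratic:
  fixes a c :: real
  assumes "c > 0"
  shows "integrable lborel (\<lambda>x. exp (a * x - c * x\<^sup>2))"
proof -
  \<comment> \<open>The standard deviation whose normal density has leading exponent
    \<open>- c * x\<^sup>2\<close>; completing the square puts the mean at a / (2 c).\<close>
  define s where "s = 1 / sqrt (2 * c)"
  have s: "s > 0" "s\<^sup>2 = 1 / (2 * c)"
    using assms by (simp_all add: s_def power_divide)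
  have "a * x - c * x\<^sup>2 = a\<^sup>2 / (4 * c) - (x - a / (2 * c))\<^sup>2 / (2 * s\<^sup>2)" for x
  proof -
    have "(x - a / (2 * c))\<^sup>2 / (2 * s\<^sup>2) = c * (x - a / (2 * c))\<^sup>2"
      using assms by (simp add: s(2))
    also have "\<dots> = c * x\<^sup>2 - a * x + a\<^sup>2 / (4 * c)"
      using assms by (simp add: power2_eq_square field_simps)
    finally show ?thesis by simp
  qed
  then have "exp (a * x - c * x\<^sup>2) =
      exp (a\<^sup>2 / (4 * c)) * sqrt (2 * pi * s\<^sup>2) * normal_density (a / (2 * c)) s x" for x
    using s(1) by (simp add: normal_density_def flip: exp_add)
  then show ?thesis
    using integrable_normal_density [OF s(1)] by simp
qed

text \<open>A single term of the series of exp |x| is below its sum. Splitting exp |x| into two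
  exponentials makes a power of x cost only a shift of the linear coefficient by 1 in either
  direction.\<close>

lemma power_exp_le:
  fixes x :: real
  shows "\<bar>x\<bar> ^ m \<le> fact m * (exp x + exp (- x))"
proof -
  have "\<bar>x\<bar> ^ m / fact m \<le> exp \<bar>x\<bar>"
  proof -
    have "(\<lambda>n. \<bar>x\<bar> ^ n / fact n) sums exp \<bar>x\<bar>"
      using exp_converges [of "\<bar>x\<bar>"] by (simp add: divide_inverse mult.commute)
    then have "(\<Sum>n\<in>{m}. \<bar>x\<bar> ^ n / fact n) \<le> exp \<bar>x\<bar>"
      by (metis (no_types, lifting) sum_le_suminf sums_iff abs_ge_zero divide_nonneg_nonneg fact_ge_zero
          finite.intros zero_le_power)
    then show ?thesis by simp
  qed
  also have "\<dots> \<le> exp x + exp (- x)"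
    by (cases "x \<ge> 0") simp_all
  finally show ?thesis
    by (simp add: field_simps)
qed

lemma integrable_power_exp_quadratic:
  fixes a :: complex and c :: real
  assumes "c > 0"
  shows "integrable lborel
    (\<lambda>x. complex_of_real x ^ m * exp (a * complex_of_real x - complex_of_real (c * x\<^sup>2)))"
proof (rule Bochner_Integration.integrable_bound)
  show "integrable lborel (\<lambda>x. fact m * (exp ((Re a + 1) * x - c * x\<^sup>2) + exp ((Re a - 1) * x - c * x\<^sup>2)))"
    using integrable_exp_quadratic [OF assms] by simp
  show "AE x in lborel. cmod (complex_of_real x ^ m * exp (a * complex_of_real x - complex_of_real (c * x\<^sup>2)))
    \<le> norm (fact m * (exp ((Re a + 1) * x - c * x\<^sup>2) + exp ((Re a - 1) * x - c * x\<^sup>2)))"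
  proof (intro AE_I2)
    fix x :: real
    have "cmod (complex_of_real x ^ m * exp (a * complex_of_real x - complex_of_real (c * x\<^sup>2)))
      = \<bar>x\<bar> ^ m * exp (Re a * x - c * x\<^sup>2)"
      by (simp add: norm_mult norm_power)
    also have "\<dots> \<le> (fact m * (exp x + exp (- x))) * exp (Re a * x - c * x\<^sup>2)"
      by (intro mult_right_mono power_exp_le) simp
    also have "\<dots> = fact m * (exp ((Re a + 1) * x - c * x\<^sup>2) + exp ((Re a - 1) * x - c * x\<^sup>2))"
      by (simp add: algebra_simps flip: exp_add)
    finally show "cmod (complex_of_real x ^ m * exp (a * complex_of_real x - complex_of_real (c * x\<^sup>2)))
        \<le> norm (fact m * (exp ((Re a + 1) * x - c * x\<^sup>2) + exp ((Re a - 1) * x - c * x\<^sup>2)))"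
      by simp
  qed
qed simp

text \<open>This is the characteristic function of the standard normal distribution at t / sqrt 2;
  the substitution of sqrt 2 x for x turns the weight exp (- x^2 / 2) into exp (- x^2).\<close>

lemma integral_exp_imaginary_gaussian:
  fixes t :: real
  shows "(\<integral>x. exp (\<i> * complex_of_real (t * x) - complex_of_real (x\<^sup>2)) \<partial>lborel) =
    complex_of_real (sqrt pi * exp (- t\<^sup>2 / 4))"
proof -
  have "complex_of_real (exp (- (t / sqrt 2)\<^sup>2 / 2)) = char std_normal_distribution (t / sqrt 2)"
    by (simp add: char_std_normal_distribution)
  also have "\<dots> = (\<integral>x. std_normal_density x *\<^sub>R iexp (t / sqrt 2 * x) \<partial>lborel)"
    unfolding char_def by (rule integral_density) (auto simp: normal_density_nonneg)
  also have "\<dots> = \<bar>sqrt 2\<bar> *\<^sub>R (\<integral>x. std_normal_density (0 + sqrt 2 * x) *\<^sub>R iexp (t / sqrt 2 * (0 + sqrt 2 * x)) \<partial>lborel)"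
    by (rule lborel_integral_real_affine) simp
  also have "\<dots> = (\<integral>x. complex_of_real (1 / sqrt pi) * exp (\<i> * complex_of_real (t * x) - complex_of_real (x\<^sup>2)) \<partial>lborel)"
    unfolding integral_scaleR_right [symmetric]
  proof (intro Bochner_Integration.integral_cong refl)
    fix x :: real
    have "exp (\<i> * complex_of_real (t * x) - complex_of_real (x\<^sup>2)) =
      complex_of_real (exp (- x\<^sup>2)) * iexp (t * x)"
      unfolding exp_of_real [symmetric] exp_add [symmetric]
      by (intro arg_cong [of _ _ exp]) simp
    moreover have "complex_of_real (sqrt 2 * std_normal_density (0 + sqrt 2 * x)) =
        complex_of_real (1 / sqrt pi * exp (- x\<^sup>2))"
      by (simp add: std_normal_density_def real_sqrt_mult power_mult_distrib)
    moreover have "t / sqrt 2 * (0 + sqrt 2 * x) = t * x"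
      by simp
    ultimately show "\<bar>sqrt 2\<bar> *\<^sub>R std_normal_density (0 + sqrt 2 * x) *\<^sub>R iexp (t / sqrt 2 * (0 + sqrt 2 * x)) =
        complex_of_real (1 / sqrt pi) * exp (\<i> * complex_of_real (t * x) - complex_of_real (x\<^sup>2))"
      by (simp only: scaleR_scaleR abs_of_nonneg real_sqrt_ge_zero zero_le_numeral scaleR_conv_of_real
        of_real_mult mult.assoc [symmetric])
  qed
  also have "\<dots> = complex_of_real (1 / sqrt pi) *
      (\<integral>x. exp (\<i> * complex_of_real (t * x) - complex_of_real (x\<^sup>2)) \<partial>lborel)"
    by (rule integral_mult_right_zero)
  finally have "complex_of_real (sqrt pi) * complex_of_real (exp (- (t / sqrt 2)\<^sup>2 / 2)) =
      complex_of_real (sqrt pi) * complex_of_real (1 / sqrt pi) *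
      (\<integral>x. exp (\<i> * complex_of_real (t * x) - complex_of_real (x\<^sup>2)) \<partial>lborel)"
    by (simp only: mult.assoc)
  moreover have "complex_of_real (sqrt pi) * complex_of_real (1 / sqrt pi) = 1"
    by (simp flip: of_real_mult)
  moreover have "- (t / sqrt 2)\<^sup>2 / 2 = - t\<^sup>2 / 4"
    by (simp add: power_divide)
  ultimately have "complex_of_real (sqrt pi) * complex_of_real (exp (- t\<^sup>2 / 4)) =
      (\<integral>x. exp (\<i> * complex_of_real (t * x) - complex_of_real (x\<^sup>2)) \<partial>lborel)"
    by (simp only: mult_1_left)
  then show ?thesis
    unfolding of_real_mult [of "sqrt pi"] by (rule sym)
qed

text \<open>A real translation by Re a / 2 absorbs the real part of the linear coefficient, so the
  purely imaginary case suffices and no contour has to be moved.\<close>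

lemma integral_exp_quadratic:
  fixes a :: complex
  shows "(\<integral>x. exp (a * complex_of_real x - complex_of_real (x\<^sup>2)) \<partial>lborel) =
    complex_of_real (sqrt pi) * exp (a\<^sup>2 / 4)"
proof -
  define r t where "r = Re a / 2" and "t = Im a"
  have a: "a = 2 * complex_of_real r + \<i> * complex_of_real t"
    by (simp add: r_def t_def complex_eq_iff)
  have "(\<integral>x. exp (a * complex_of_real x - complex_of_real (x\<^sup>2)) \<partial>lborel) =
    \<bar>1\<bar> *\<^sub>R (\<integral>x. exp (a * complex_of_real (r + 1 * x) - complex_of_real ((r + 1 * x)\<^sup>2)) \<partial>lborel)"
    by (rule lborel_integral_real_affine) simp
  also have "\<dots> = (\<integral>x. exp (complex_of_real (r\<^sup>2) + \<i> * complex_of_real (r * t)) *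
      exp (\<i> * complex_of_real (t * x) - complex_of_real (x\<^sup>2)) \<partial>lborel)"
    unfolding exp_add [symmetric] abs_one scaleR_one
    by (intro Bochner_Integration.integral_cong refl arg_cong [of _ _ exp])
      (simp add: a algebra_simps power2_eq_square)
  also have "\<dots> = exp (complex_of_real (r\<^sup>2) + \<i> * complex_of_real (r * t)) *
      complex_of_real (sqrt pi * exp (- t\<^sup>2 / 4))"
    by (simp only: integral_mult_right_zero integral_exp_imaginary_gaussian)
  also have "\<dots> = complex_of_real (sqrt pi) *
      (exp (complex_of_real (r\<^sup>2) + \<i> * complex_of_real (r * t)) * exp (complex_of_real (- t\<^sup>2 / 4)))"
    by (simp only: of_real_mult exp_of_real mult_ac)
  also have "\<dots> = complex_of_real (sqrt pi) * exp (a\<^sup>2 / 4)"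
    unfolding exp_add [symmetric]
    by (intro arg_cong2 [of _ _ _ _ "(*)"] arg_cong [of _ _ exp] refl)
      (simp add: a power2_eq_square field_simps)
  finally show ?thesis .
qed

text \<open>The fundamental theorem of calculus on the whole line; it serves as integration by parts
  in the recursion for the moments.\<close>

lemma integral_derivative_eq_0:
  fixes F f :: "real \<Rightarrow> complex"
  assumes "\<And>x. (F has_vector_derivative f x) (at x)" and "continuous_on UNIV f"
    and "integrable lborel f" and "(F \<longlongrightarrow> 0) at_top" and "(F \<longlongrightarrow> 0) at_bot"
  shows "integral\<^sup>L lborel f = 0"
proof -
  have "(LBINT x=-\<infinity>..\<infinity>. f x) = 0 - 0"
  proof (rule interval_integral_FTC_integrable [where F = F])
    show "((F \<circ> real_of_ereal) \<longlongrightarrow> 0) (at_right (- \<infinity>))"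
      using assms(5) by (simp add: ereal_tendsto_simps)
    show "((F \<circ> real_of_ereal) \<longlongrightarrow> 0) (at_left \<infinity>)"
      using assms(4) by (simp add: ereal_tendsto_simps)
    show "set_integrable lborel (einterval (- \<infinity>) \<infinity>) f"
      using assms(3) by (simp add: set_integrable_def)
  qed (use assms in \<open>auto simp: continuous_on_eq_continuous_at\<close>)
  then show ?thesis
    by (simp add: interval_lebesgue_integral_def set_lebesgue_integral_def)
qed

lemma power_exp_quadratic_tendsto_0:
  fixes a :: complex
  shows "((\<lambda>x. complex_of_real x ^ m * exp (a * complex_of_real x - complex_of_real (x\<^sup>2))) \<longlongrightarrow> 0) at_top"
    and "((\<lambda>x. complex_of_real x ^ m * exp (a * complex_of_real x - complex_of_real (x\<^sup>2))) \<longlongrightarrow> 0) at_bot"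
proof -
  \<comment> \<open>The imaginary part of a only contributes a phase, so the limits are those of a
    real function.\<close>
  have norm: "norm (complex_of_real x ^ m * exp (a * complex_of_real x - complex_of_real (x\<^sup>2))) =
      norm (x ^ m * exp (Re a * x - x\<^sup>2))" for x
    by (simp add: norm_mult norm_power abs_mult power_abs)
  have "((\<lambda>x. norm (x ^ m * exp (Re a * x - x\<^sup>2))) \<longlongrightarrow> 0) at_top"
    by (rule tendsto_norm_zero) real_asymp
  then show "((\<lambda>x. complex_of_real x ^ m * exp (a * complex_of_real x - complex_of_real (x\<^sup>2))) \<longlongrightarrow> 0) at_top"
    unfolding norm [symmetric] by (rule tendsto_norm_zero_cancel)
  have "((\<lambda>x. norm (x ^ m * exp (Re a * x - x\<^sup>2))) \<longlongrightarrow> 0) at_bot"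
    by (rule tendsto_norm_zero) real_asymp
  then show "((\<lambda>x. complex_of_real x ^ m * exp (a * complex_of_real x - complex_of_real (x\<^sup>2))) \<longlongrightarrow> 0) at_bot"
    unfolding norm [symmetric] by (rule tendsto_norm_zero_cancel)
qed

text \<open>Integrating the derivatives of \<open>E\<close> and of x \<open>E\<close> over the line
  gives a I0 = 2 I1 and I0 + a I1 = 2 I2 for the moments I0, I1, I2 of \<open>E\<close>.\<close>

lemma integral_mult_exp_quadratic:
  fixes a :: complex
  shows "(\<integral>x. complex_of_real x * exp (a * complex_of_real x - complex_of_real (x\<^sup>2)) \<partial>lborel) =
    complex_of_real (sqrt pi) * exp (a\<^sup>2 / 4) * (a / 2)" (is "?I1 = _")
    and "(\<integral>x. (complex_of_real x)\<^sup>2 * exp (a * complex_of_real x - complex_of_real (x\<^sup>2)) \<partial>lborel) =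
    complex_of_real (sqrt pi) * exp (a\<^sup>2 / 4) * (a\<^sup>2 / 4 + 1 / 2)" (is "?I2 = _")
proof -
  define E where "E = (\<lambda>x. exp (a * complex_of_real x - complex_of_real (x\<^sup>2)))"
  have I12: "?I1 = (\<integral>x. complex_of_real x * E x \<partial>lborel)"
    "?I2 = (\<integral>x. (complex_of_real x)\<^sup>2 * E x \<partial>lborel)"
    by (simp_all only: E_def)
  have deriv: "(E has_vector_derivative (a - 2 * complex_of_real x) * E x) (at x)" for x
    unfolding E_def of_real_power
    by (rule has_vector_derivative_real_field [where f = "\<lambda>z. exp (a * z - z\<^sup>2)"])
      (auto intro!: derivative_eq_intros)
  have cont: "continuous_on UNIV E"
    unfolding E_def by (intro continuous_intros)
  have int: "integrable lborel (\<lambda>x. complex_of_real x ^ m * E x)" for m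
    using integrable_power_exp_quadratic [of 1 m a] by (simp add: E_def)
  note int [of 0, simplified, simp] int [of 1, simplified, simp] int [of 2, simp]
  have lim: "((\<lambda>x. complex_of_real x ^ m * E x) \<longlongrightarrow> 0) at_top"
    "((\<lambda>x. complex_of_real x ^ m * E x) \<longlongrightarrow> 0) at_bot" for m
    unfolding E_def by (rule power_exp_quadratic_tendsto_0)+
  have I0: "integral\<^sup>L lborel E = complex_of_real (sqrt pi) * exp (a\<^sup>2 / 4)"
    unfolding E_def by (rule integral_exp_quadratic)
  have "integral\<^sup>L lborel (\<lambda>x. a * E x - 2 * (complex_of_real x * E x)) = 0"
  proof (rule integral_derivative_eq_0)
    show "(E has_vector_derivative a * E x - 2 * (complex_of_real x * E x)) (at x)" for x
      using deriv [of x] by (simp add: algebra_simps)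
  qed (use lim [of 0] in \<open>auto intro!: continuous_intros cont\<close>)
  then have I1: "a * integral\<^sup>L lborel E = 2 * ?I1"
    unfolding I12 by simp
  then show "?I1 = complex_of_real (sqrt pi) * exp (a\<^sup>2 / 4) * (a / 2)"
    by (simp add: I0 field_simps)
  have "integral\<^sup>L lborel (\<lambda>x. E x + a * (complex_of_real x * E x) - 2 * ((complex_of_real x)\<^sup>2 * E x)) = 0"
  proof (rule integral_derivative_eq_0)
    show "((\<lambda>x. complex_of_real x * E x) has_vector_derivative
        E x + a * (complex_of_real x * E x) - 2 * ((complex_of_real x)\<^sup>2 * E x)) (at x)" for x
      by (rule derivative_eq_intros deriv refl | simp add: algebra_simps power2_eq_square)+
  qed (use lim [of 1] in \<open>auto intro!: continuous_intros cont\<close>)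
  then have "integral\<^sup>L lborel E + a * ?I1 = 2 * ?I2"
    unfolding I12 by simp
  then have "?I2 = (integral\<^sup>L lborel E + a * (a * integral\<^sup>L lborel E / 2)) / 2"
    by (simp add: I1)
  then show "?I2 = complex_of_real (sqrt pi) * exp (a\<^sup>2 / 4) * (a\<^sup>2 / 4 + 1 / 2)"
    by (simp add: I0 power2_eq_square field_simps)
qed

section \<open>Gaussian moments in several real variables\<close>

lemma prod_exp_quadratic:
  fixes a :: "'a::euclidean_space \<Rightarrow> complex"
  shows "(\<Prod>b\<in>Basis. complex_of_real (x \<bullet> b) ^ m b *
      exp (a b * complex_of_real (x \<bullet> b) - complex_of_real (c * (x \<bullet> b)\<^sup>2))) =
    (\<Prod>b\<in>Basis. complex_of_real (x \<bullet> b) ^ m b) *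
      exp ((\<Sum>b\<in>Basis. a b * complex_of_real (x \<bullet> b)) - complex_of_real (c * (x \<bullet> x)))"
proof -
  have "complex_of_real (c * (x \<bullet> x)) = (\<Sum>b\<in>Basis. complex_of_real (c * (x \<bullet> b)\<^sup>2))"
    by (subst euclidean_inner) (simp add: power2_eq_square sum_distrib_left)
  then show ?thesis
    by (simp only: prod.distrib sum_subtractf [symmetric] exp_sum finite_Basis)
qed

lemma integrable_moment_exp_quadratic:
  fixes a :: "'a::euclidean_space \<Rightarrow> complex"
  assumes "c > 0"
  shows "integrable lborel (\<lambda>x. (\<Prod>b\<in>Basis. complex_of_real (x \<bullet> b) ^ m b) *
      exp ((\<Sum>b\<in>Basis. a b * complex_of_real (x \<bullet> b)) - complex_of_real (c * (x \<bullet> x))))"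
  using has_bochner_integral_lborel_prod [OF integrable_power_exp_quadratic [OF assms], of m a]
  unfolding prod_exp_quadratic by (auto simp: has_bochner_integral_iff)

text \<open>The weight is exp (- |x|^2), without a factor 1/2, because this is what the Bargmann
  kernel times a Gaussian preimage and the Weyl integrand both produce.\<close>

definition gaussian :: "('a::euclidean_space \<Rightarrow> complex) \<Rightarrow> 'a \<Rightarrow> complex" where
  "gaussian a x = exp ((\<Sum>b\<in>Basis. a b * complex_of_real (x \<bullet> b)) - complex_of_real (x \<bullet> x))"

text \<open>The total integral of \<open>gaussian a\<close>, kept as a common factor of all
  moments.\<close>

definition gaussian_mass :: "('a::euclidean_space \<Rightarrow> complex) \<Rightarrow> complex" where
  "gaussian_mass a = complex_of_real (sqrt pi ^ DIM('a)) * exp ((\<Sum>b\<in>Basis. (a b)\<^sup>2) / 4)"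

text \<open>The integral factors over the coordinates; the conditional lists the moments of orders
  0, 1, 2 for mean a / 2 and variance 1/2. Exponents up to 2 are what quadratic kernels call
  for.\<close>

lemma has_bochner_integral_gaussian_moments:
  fixes a :: "'a::euclidean_space \<Rightarrow> complex"
  assumes "\<And>b. b \<in> Basis \<Longrightarrow> m b \<le> 2"
  shows "has_bochner_integral lborel (\<lambda>x. (\<Prod>b\<in>Basis. complex_of_real (x \<bullet> b) ^ m b) * gaussian a x)
    (gaussian_mass a * (\<Prod>b\<in>Basis. if m b = 0 then 1 else if m b = 1 then a b / 2 else (a b)\<^sup>2 / 4 + 1 / 2))"
proof -
  let ?v = "\<lambda>b. if m b = 0 then 1 else if m b = 1 then a b / 2 else (a b)\<^sup>2 / 4 + 1 / 2"
  have "(\<integral>x. complex_of_real x ^ m b * exp (a b * complex_of_real x - complex_of_real (1 * x\<^sup>2)) \<partial>lborel) =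
      complex_of_real (sqrt pi) * exp ((a b)\<^sup>2 / 4) * ?v b" if "b \<in> Basis" for b
  proof -
    have "m b \<le> 2"
      using assms that by blast
    then consider "m b = 0" | "m b = 1" | "m b = 2"
      by linarith
    then show ?thesis
      by cases (use integral_exp_quadratic [of "a b"] integral_mult_exp_quadratic [of "a b"] in simp_all)
  qed
  then have "(\<Prod>b\<in>Basis. \<integral>x. complex_of_real x ^ m b *
        exp (a b * complex_of_real x - complex_of_real (1 * x\<^sup>2)) \<partial>lborel) =
      (\<Prod>b\<in>Basis. complex_of_real (sqrt pi) * exp ((a b)\<^sup>2 / 4) * ?v b)"
    by (intro prod.cong refl)
  also have "\<dots> = gaussian_mass a * (\<Prod>b\<in>Basis. ?v b)"
    by (simp only: prod.distrib prod_constant gaussian_mass_def sum_divide_distrib exp_sum finite_Basis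
        of_real_power)
  finally show ?thesis
    using has_bochner_integral_lborel_prod [OF integrable_power_exp_quadratic [of 1], of m a]
    unfolding prod_exp_quadratic by (simp add: gaussian_def)
qed

lemma has_bochner_integral_gaussian:
  "has_bochner_integral lborel (gaussian a) (gaussian_mass a)"
  using has_bochner_integral_gaussian_moments [of "\<lambda>_. 0" a] by simp

lemma prod_power_single:
  assumes "b \<in> Basis"
  shows "(\<Prod>i\<in>Basis. complex_of_real (x \<bullet> i) ^ (if i = b then 1 else 0)) = complex_of_real (x \<bullet> b)"
  using assms by (simp add: if_distrib [of "\<lambda>k. _ ^ k"] cong: if_cong)

text \<open>Adding the two indicator exponents yields the exponent 2 when the basis vectors
  coincide, so squares and mixed products share one formula.\<close>

lemma prod_power_pair:
  assumes "b \<in> Basis" "b' \<in> Basis"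
  shows "(\<Prod>i\<in>Basis. complex_of_real (x \<bullet> i) ^ ((if i = b then 1 else 0) + (if i = b' then 1 else 0))) =
    complex_of_real (x \<bullet> b) * complex_of_real (x \<bullet> b')"
  unfolding power_add prod.distrib by (simp only: prod_power_single assms)

lemma has_bochner_integral_gaussian_1:
  assumes "b \<in> Basis"
  shows "has_bochner_integral lborel (\<lambda>x. complex_of_real (x \<bullet> b) * gaussian a x)
    (gaussian_mass a * (a b / 2))"
proof -
  define m where "m = (\<lambda>i. if i = b then 1 else 0 :: nat)"
  have 1: "(\<Prod>i\<in>Basis. complex_of_real (x \<bullet> i) ^ m i) = complex_of_real (x \<bullet> b)" for x
    unfolding m_def by (rule prod_power_single [OF assms])
  have "(\<Prod>i\<in>Basis. if m i = 0 then 1 else if m i = 1 then a i / 2 else (a i)\<^sup>2 / 4 + 1 / 2) =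
      (\<Prod>i\<in>Basis. if i = b then a i / 2 else 1)"
    by (intro prod.cong) (auto simp: m_def)
  also have "\<dots> = a b / 2"
    using assms by simp
  finally have 2: "(\<Prod>i\<in>Basis. if m i = 0 then 1 else if m i = 1 then a i / 2 else (a i)\<^sup>2 / 4 + 1 / 2) =
      a b / 2" .
  have "m i \<le> 2" for i
    by (simp add: m_def)
  then show ?thesis
    using has_bochner_integral_gaussian_moments [of m a] by (simp only: 1 2)
qed

text \<open>Distinct coordinates are independent under the Gaussian, which gives the product of the
  means; on the diagonal the variance 1/2 is added.\<close>

lemma has_bochner_integral_gaussian_2:
  assumes "b \<in> Basis" "b' \<in> Basis"
  shows "has_bochner_integral lborel (\<lambda>x. complex_of_real (x \<bullet> b) * complex_of_real (x \<bullet> b') * gaussian a x)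
    (gaussian_mass a * (a b * a b' / 4 + (if b = b' then 1 / 2 else 0)))"
proof -
  define m where "m = (\<lambda>i. (if i = b then 1 else 0) + (if i = b' then 1 else 0) :: nat)"
  have 1: "(\<Prod>i\<in>Basis. complex_of_real (x \<bullet> i) ^ m i) = complex_of_real (x \<bullet> b) * complex_of_real (x \<bullet> b')" for x
    unfolding m_def by (rule prod_power_pair [OF assms])
  have 2: "(\<Prod>i\<in>Basis. if m i = 0 then 1 else if m i = 1 then a i / 2 else (a i)\<^sup>2 / 4 + 1 / 2) =
      a b * a b' / 4 + (if b = b' then 1 / 2 else 0)"
  proof (cases "b = b'")
    case True
    then have "(\<Prod>i\<in>Basis. if m i = 0 then 1 else if m i = 1 then a i / 2 else (a i)\<^sup>2 / 4 + 1 / 2) =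
        (\<Prod>i\<in>Basis. if i = b then (a i)\<^sup>2 / 4 + 1 / 2 else 1)"
      by (intro prod.cong) (auto simp: m_def)
    then show ?thesis
      using True assms by (simp add: power2_eq_square)
  next
    case False
    then have "(\<Prod>i\<in>Basis. if m i = 0 then 1 else if m i = 1 then a i / 2 else (a i)\<^sup>2 / 4 + 1 / 2) =
        (\<Prod>i\<in>Basis. (if i = b then a i / 2 else 1) * (if i = b' then a i / 2 else 1))"
      by (intro prod.cong) (auto simp: m_def)
    then show ?thesis
      using False assms by (simp add: prod.distrib)
  qed
  have "m i \<le> 2" for i
    by (simp add: m_def)
  then show ?thesis
    using has_bochner_integral_gaussian_moments [of m a] by (simp only: 1 2)
qed

section \<open>Complex moments with respect to \<open>mu\<close>\<close>

lemma has_bochner_integral_mu: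
  fixes f :: "complex^'n::finite \<Rightarrow> complex"
  assumes "has_bochner_integral lborel f I"
  shows "has_bochner_integral mu f (I / (2 * pi) ^ CARD('n))"
proof -
  have "integrable lborel f" "integral\<^sup>L lborel f = I"
    using assms by (simp_all add: has_bochner_integral_iff)
  moreover from this have "f \<in> borel_measurable lborel"
    by simp
  ultimately show ?thesis
    unfolding mu_def has_bochner_integral_iff
    by (simp add: integrable_density integral_density scaleR_conv_of_real)
qed

lemma vec_nth_eq_inner_axis:
  fixes w :: "complex^'n::finite"
  shows "w $ j = complex_of_real (w \<bullet> axis j 1) + \<i> * complex_of_real (w \<bullet> axis j \<i>)"
  by (simp add: inner_axis inner_complex_def complex_eq_iff)

text \<open>The real dimension is 2n, so the Lebesgue mass is pi^n; dividing by (2 pi)^n leaves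
  exactly the inverse of the prefactor of the Weyl symbol.\<close>

lemma has_bochner_integral_mu_gaussian:
  "has_bochner_integral (mu :: (complex^'n::finite) measure) (gaussian (\<lambda>_. 0)) (1 / 2 ^ CARD('n))"
proof -
  have "gaussian_mass (\<lambda>_::complex^'n. 0) = complex_of_real (pi ^ CARD('n))"
    by (simp add: gaussian_mass_def power_mult mult.commute [of _ 2] flip: of_real_power)
  with has_bochner_integral_mu [OF has_bochner_integral_gaussian [of "\<lambda>_::complex^'n. 0"]] show ?thesis
    by (simp add: power_mult_distrib)
qed

lemma axis_complex_in_Basis:
  "axis j 1 \<in> (Basis :: (complex^'n::finite) set)" "axis j \<i> \<in> (Basis :: (complex^'n::finite) set)"
  by (auto simp: axis_in_Basis_iff Basis_complex_def)

lemma cnj_nth_eq_inner_axis: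
  fixes w :: "complex^'n::finite"
  shows "cnj (w $ j) = complex_of_real (w \<bullet> axis j 1) + - 1 * \<i> * complex_of_real (w \<bullet> axis j \<i>)"
  by (simp add: inner_axis inner_complex_def complex_eq_iff)

lemma has_bochner_integral_mu_basis:
  fixes b b' :: "complex^'n::finite"
  assumes "b \<in> Basis" "b' \<in> Basis"
  shows "has_bochner_integral mu (\<lambda>w. complex_of_real (w \<bullet> b) * gaussian (\<lambda>_. 0) w) 0"
    and "has_bochner_integral mu (\<lambda>w. complex_of_real (w \<bullet> b) * complex_of_real (w \<bullet> b') * gaussian (\<lambda>_. 0) w)
      (if b = b' then 1 / (2 * 2 ^ CARD('n)) else 0)"
proof -
  have "gaussian_mass (\<lambda>_::complex^'n. 0) = complex_of_real (pi ^ CARD('n))"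
    by (simp add: gaussian_mass_def power_mult mult.commute [of _ 2] flip: of_real_power)
  with has_bochner_integral_mu [OF has_bochner_integral_gaussian_1 [OF assms(1), of "\<lambda>_. 0"]]
    has_bochner_integral_mu [OF has_bochner_integral_gaussian_2 [OF assms, of "\<lambda>_. 0"]]
  show "has_bochner_integral mu (\<lambda>w. complex_of_real (w \<bullet> b) * gaussian (\<lambda>_. 0) w) 0"
    and "has_bochner_integral mu (\<lambda>w. complex_of_real (w \<bullet> b) * complex_of_real (w \<bullet> b') * gaussian (\<lambda>_. 0) w)
      (if b = b' then 1 / (2 * 2 ^ CARD('n)) else 0)"
    by (simp_all add: power_mult_distrib split: if_splits)
qed

text \<open>The sign s = 1 describes the coordinate \<open>w $ j\<close> and s = - 1 its conjugate,
  so one computation covers both.\<close>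

lemma has_bochner_integral_mu_linear:
  fixes s :: complex
  shows "has_bochner_integral (mu :: (complex^'n::finite) measure)
    (\<lambda>w. (complex_of_real (w \<bullet> axis j 1) + s * \<i> * complex_of_real (w \<bullet> axis j \<i>)) * gaussian (\<lambda>_. 0) w) 0"
proof -
  have "has_bochner_integral (mu :: (complex^'n) measure)
    (\<lambda>w. complex_of_real (w \<bullet> axis j 1) * gaussian (\<lambda>_. 0) w +
      s * \<i> * (complex_of_real (w \<bullet> axis j \<i>) * gaussian (\<lambda>_. 0) w)) (0 + s * \<i> * 0)"
    by (intro has_bochner_integral_add has_bochner_integral_mult_right axis_complex_in_Basis
      has_bochner_integral_mu_basis(1) [OF _ axis_complex_in_Basis(1)])
  then show ?thesis
    by (simp add: algebra_simps)
qed

text \<open>Real and imaginary parts are uncorrelated with equal variance, and the product of the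
  two imaginary terms carries the sign - s s'. Thus 1 - s s' vanishes for two factors of the same
  kind and is 2 for a coordinate against a conjugate.\<close>

lemma has_bochner_integral_mu_bilinear:
  fixes s s' :: complex
  shows "has_bochner_integral (mu :: (complex^'n::finite) measure)
    (\<lambda>w. (complex_of_real (w \<bullet> axis j 1) + s * \<i> * complex_of_real (w \<bullet> axis j \<i>)) *
      (complex_of_real (w \<bullet> axis k 1) + s' * \<i> * complex_of_real (w \<bullet> axis k \<i>)) * gaussian (\<lambda>_. 0) w)
    (if j = k then (1 - s * s') / (2 * 2 ^ CARD('n)) else 0)"
proof -
  let ?G = "\<lambda>b b' w. complex_of_real (w \<bullet> b) * complex_of_real (w \<bullet> b') * gaussian (\<lambda>_::complex^'n. 0) w"
  let ?I = "\<lambda>b b'::complex^'n. if b = b' then 1 / (2 * 2 ^ CARD('n)) else 0 :: complex"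
  have "has_bochner_integral mu
    (\<lambda>w. ?G (axis j 1) (axis k 1) w + s' * \<i> * ?G (axis j 1) (axis k \<i>) w +
      s * \<i> * ?G (axis j \<i>) (axis k 1) w + - (s * s') * ?G (axis j \<i>) (axis k \<i>) w)
    (?I (axis j 1) (axis k 1) + s' * \<i> * ?I (axis j 1) (axis k \<i>) +
      s * \<i> * ?I (axis j \<i>) (axis k 1) + - (s * s') * ?I (axis j \<i>) (axis k \<i>))"
    by (intro has_bochner_integral_add has_bochner_integral_mult_right has_bochner_integral_mu_basis(2)
      axis_complex_in_Basis)
  moreover have "?I (axis j 1) (axis k 1) + s' * \<i> * ?I (axis j 1) (axis k \<i>) +
      s * \<i> * ?I (axis j \<i>) (axis k 1) + - (s * s') * ?I (axis j \<i>) (axis k \<i>) =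
    (if j = k then (1 - s * s') / (2 * 2 ^ CARD('n)) else 0)"
    by (simp add: axis_eq_axis diff_divide_distrib)
  moreover have "?G (axis j 1) (axis k 1) w + s' * \<i> * ?G (axis j 1) (axis k \<i>) w +
      s * \<i> * ?G (axis j \<i>) (axis k 1) w + - (s * s') * ?G (axis j \<i>) (axis k \<i>) w =
    (complex_of_real (w \<bullet> axis j 1) + s * \<i> * complex_of_real (w \<bullet> axis j \<i>)) *
      (complex_of_real (w \<bullet> axis k 1) + s' * \<i> * complex_of_real (w \<bullet> axis k \<i>)) * gaussian (\<lambda>_. 0) w" for w
  proof -
    have "p * q * g + s' * \<i> * (p * v * g) + s * \<i> * (u * q * g) + - (s * s') * (u * v * g) =
      (p + s * \<i> * u) * (q + s' * \<i> * v) * g" for p q u v g :: complex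
    proof -
      have "(p + s * \<i> * u) * (q + s' * \<i> * v) * g =
          p * q * g + s' * \<i> * (p * v * g) + s * \<i> * (u * q * g) + (\<i> * \<i>) * (s * s') * (u * v * g)"
        by (simp add: algebra_simps)
      then show ?thesis by simp
    qed
    then show ?thesis .
  qed
  ultimately show ?thesis
    by simp
qed

lemma has_bochner_integral_mu_moments:
  fixes j k :: "'n::finite"
  shows "has_bochner_integral (mu :: (complex^'n) measure) (\<lambda>w. w $ j * gaussian (\<lambda>_. 0) w) 0"
    and "has_bochner_integral (mu :: (complex^'n) measure) (\<lambda>w. cnj (w $ j) * gaussian (\<lambda>_. 0) w) 0"
    and "has_bochner_integral (mu :: (complex^'n) measure) (\<lambda>w. w $ j * w $ k * gaussian (\<lambda>_. 0) w) 0"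
    and "has_bochner_integral (mu :: (complex^'n) measure) (\<lambda>w. cnj (w $ j) * cnj (w $ k) * gaussian (\<lambda>_. 0) w) 0"
    and "has_bochner_integral (mu :: (complex^'n) measure) (\<lambda>w. w $ j * cnj (w $ k) * gaussian (\<lambda>_. 0) w)
      (if j = k then 1 / 2 ^ CARD('n) else 0)"
  using has_bochner_integral_mu_linear [of j 1] has_bochner_integral_mu_linear [of j "- 1"]
    has_bochner_integral_mu_bilinear [of j 1 k 1] has_bochner_integral_mu_bilinear [of j "- 1" k "- 1"]
    has_bochner_integral_mu_bilinear [of j 1 k "- 1"]
  unfolding cnj_nth_eq_inner_axis [symmetric] mult_1_left vec_nth_eq_inner_axis [symmetric]
  by (simp_all cong: if_cong)

section \<open>The range of the Bargmann transform\<close>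

lemma bil_simps:
  "bil (x + y) z = bil x z + bil y z" "bil z (x + y) = bil z x + bil z y"
  "bil (x - y) z = bil x z - bil y z" "bil z (x - y) = bil z x - bil z y"
  "bil (- x) z = - bil x z" "bil z (- x) = - bil z x"
  "bil (c *s x) z = c * bil x z" "bil z (c *s x) = c * bil z x"
  "bil 0 z = 0" "bil z 0 = 0"
  by (simp_all add: bil_def sum.distrib sum_subtractf sum_negf sum_distrib_left algebra_simps)

lemma bil_commute: "bil x y = bil y x"
  by (simp add: bil_def mult.commute)

lemma sum_Basis_real_vec:
  fixes f :: "real^'n::finite \<Rightarrow> 'b::comm_monoid_add"
  shows "(\<Sum>b\<in>Basis. f b) = (\<Sum>j\<in>UNIV. f (axis j 1))"
proof -
  have "(Basis :: (real^'n) set) = range (\<lambda>j. axis j 1)"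
    by (auto simp: Basis_vec_def)
  moreover have "sum f (range (\<lambda>j. axis j 1)) = (\<Sum>j\<in>UNIV. f (axis j 1))"
    by (subst sum.reindex) (auto simp: inj_on_def axis_eq_axis)
  ultimately show ?thesis
    by simp
qed

lemma bil_cvec_axis [simp]: "bil u (cvec (axis j 1)) = u $ j"
  by (simp add: bil_def cvec_def axis_def if_distrib cong: if_cong)

lemma sum_Basis_bil_cvec:
  "(\<Sum>b\<in>Basis. bil u (cvec b) * complex_of_real (x \<bullet> b)) = bil u (cvec x)"
  unfolding sum_Basis_real_vec by (simp add: inner_axis) (simp add: bil_def cvec_def)

lemma gaussian_bil:
  "gaussian (\<lambda>b. bil u (cvec b)) x = exp (bil u (cvec x) - complex_of_real (x \<bullet> x))"
  by (simp add: gaussian_def sum_Basis_bil_cvec)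

lemma gaussian_mass_bil:
  "gaussian_mass (\<lambda>b::real^'n::finite. bil u (cvec b)) = complex_of_real (sqrt pi ^ CARD('n)) * exp (bil u u / 4)"
  by (simp add: gaussian_mass_def sum_Basis_real_vec power2_eq_square) (simp add: bil_def)

text \<open>One family in two roles: \<open>half_gaussian z\<close> is the Bargmann kernel without
  exp (- z^2 / 4), and \<open>half_gaussian u\<close> is, up to a constant, the preimage of exp (u z
  / 2).\<close>

definition half_gaussian :: "complex^'n::finite \<Rightarrow> real^'n \<Rightarrow> complex" where
  "half_gaussian u x = exp (bil u (cvec x) - complex_of_real (x \<bullet> x) / 2)"

lemma half_gaussian_mult:
  "half_gaussian u x * half_gaussian v x = gaussian (\<lambda>b. bil (u + v) (cvec b)) x"
  unfolding gaussian_bil by (simp add: half_gaussian_def bil_simps flip: exp_add)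

lemma continuous_on_bil [continuous_intros]:
  "continuous_on S f \<Longrightarrow> continuous_on S g \<Longrightarrow> continuous_on S (\<lambda>x. bil (f x) (g x))"
  unfolding bil_def by (intro continuous_intros)

lemma continuous_on_cvec [continuous_intros]:
  "continuous_on S f \<Longrightarrow> continuous_on S (\<lambda>x. cvec (f x))"
  unfolding cvec_def by (intro continuous_intros)

lemma continuous_on_half_gaussian: "continuous_on UNIV (half_gaussian u)"
  unfolding half_gaussian_def by (intro continuous_intros) auto

lemma half_gaussian_moment_in_L2:
  fixes u :: "complex^'n::finite"
  shows "(\<lambda>x. (\<Prod>b\<in>Basis. complex_of_real (x \<bullet> b) ^ m b) * half_gaussian u x) \<in> L2_functions"
  (is "?\<phi> \<in> _")
proof -
  have "?\<phi> \<in> borel_measurable lborel"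
    by (simp, intro borel_measurable_continuous_onI continuous_intros continuous_on_half_gaussian)
  moreover have "integrable lborel (\<lambda>x. (cmod (?\<phi> x))\<^sup>2)"
  proof -
    \<comment> \<open>The squared modulus is again a monomial times a Gaussian, with doubled
      exponents and the real linear coefficient u plus its conjugate; its integrability is therefore
      already known.\<close>
    have eq: "?\<phi> x * cnj (?\<phi> x) = (\<Prod>b\<in>Basis. complex_of_real (x \<bullet> b) ^ (2 * m b)) *
        gaussian (\<lambda>b. bil (u + cnj_vec u) (cvec b)) x" for x
    proof -
      define P where "P = (\<Prod>b\<in>Basis. complex_of_real (x \<bullet> b) ^ m b)"
      have 1: "cnj (half_gaussian u x) = half_gaussian (cnj_vec u) x"
        by (simp add: half_gaussian_def exp_cnj bil_def cnj_vec_def cvec_def)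
      have 2: "(\<Prod>b\<in>Basis. complex_of_real (x \<bullet> b) ^ (2 * m b)) = P * P"
        by (simp only: mult_2 power_add prod.distrib P_def)
      have 3: "cnj P = P"
        by (simp add: P_def)
      show ?thesis
        unfolding half_gaussian_mult [symmetric] 2 complex_cnj_mult P_def [symmetric] 1 3
        by (simp only: mult_ac)
    qed
    have "(cmod (?\<phi> x))\<^sup>2 = cmod ((\<Prod>b\<in>Basis. complex_of_real (x \<bullet> b) ^ (2 * m b)) *
        gaussian (\<lambda>b. bil (u + cnj_vec u) (cvec b)) x)" for x
      unfolding eq [symmetric] by (simp add: norm_mult power2_eq_square)
    then show ?thesis
      using integrable_norm [OF integrable_moment_exp_quadratic [of 1 "\<lambda>b. 2 * m b"
            "\<lambda>b. bil (u + cnj_vec u) (cvec b)"]]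
      by (simp add: gaussian_def)
  qed
  ultimately show ?thesis
    by (simp add: L2_functions_def)
qed

lemma half_gaussian_in_L2:
  fixes u :: "complex^'n::finite"
  shows "half_gaussian u \<in> L2_functions"
  "(\<lambda>x. complex_of_real (x $ j) * half_gaussian u x) \<in> L2_functions"
  "(\<lambda>x. complex_of_real (x $ j) * complex_of_real (x $ k) * half_gaussian u x) \<in> L2_functions"
proof -
  have axis: "axis i 1 \<in> (Basis :: (real^'n) set)" for i :: 'n
    by (simp add: axis_in_Basis_iff)
  show "half_gaussian u \<in> L2_functions"
    using half_gaussian_moment_in_L2 [of "\<lambda>_. 0" u] by simp
  show "(\<lambda>x. complex_of_real (x $ j) * half_gaussian u x) \<in> L2_functions"
    using half_gaussian_moment_in_L2 [of "\<lambda>i. if i = axis j 1 then 1 else 0" u]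
    unfolding prod_power_single [OF axis] by (simp add: inner_axis)
  show "(\<lambda>x. complex_of_real (x $ j) * complex_of_real (x $ k) * half_gaussian u x) \<in> L2_functions"
    using half_gaussian_moment_in_L2
      [of "\<lambda>i. (if i = axis j 1 then 1 else 0) + (if i = axis k 1 then 1 else 0)" u]
    unfolding prod_power_pair [OF axis axis] by (simp add: inner_axis)
qed

lemma bargmann_kernel_eq:
  "exp (- bil z z / 4 + bil z (cvec x) - complex_of_real (x \<bullet> x) / 2) = exp (- bil z z / 4) * half_gaussian z x"
  unfolding half_gaussian_def exp_add [symmetric] by (rule arg_cong [of _ _ exp]) simp

lemma integrable_mult_L2:
  assumes "\<phi> \<in> L2_functions" "\<psi> \<in> L2_functions"
  shows "integrable lborel (\<lambda>x. \<phi> x * \<psi> x)"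
proof (rule Bochner_Integration.integrable_bound)
  show "integrable lborel (\<lambda>x. (cmod (\<phi> x))\<^sup>2 + (cmod (\<psi> x))\<^sup>2)"
    using assms by (simp add: L2_functions_def)
  show "(\<lambda>x. \<phi> x * \<psi> x) \<in> borel_measurable lborel"
    using assms by (auto simp: L2_functions_def intro!: borel_measurable_times)
  have "p * q \<le> p\<^sup>2 + q\<^sup>2" if "p \<ge> 0" "q \<ge> 0" for p q :: real
  proof -
    have "2 * (p * q) \<le> p\<^sup>2 + q\<^sup>2"
      using sum_squares_bound [of p q] by (simp add: mult.assoc)
    then show ?thesis using mult_nonneg_nonneg [OF that] by linarith
  qed
  then show "AE x in lborel. cmod (\<phi> x * \<psi> x) \<le> norm ((cmod (\<phi> x))\<^sup>2 + (cmod (\<psi> x))\<^sup>2)"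
    by (simp add: norm_mult)
qed

lemma L2_functions_add:
  assumes "\<phi> \<in> L2_functions" "\<psi> \<in> L2_functions"
  shows "(\<lambda>x. \<phi> x + \<psi> x) \<in> L2_functions"
proof -
  have "integrable lborel (\<lambda>x. (cmod (\<phi> x + \<psi> x))\<^sup>2)"
  proof (rule Bochner_Integration.integrable_bound)
    show "integrable lborel (\<lambda>x. 2 * (cmod (\<phi> x))\<^sup>2 + 2 * (cmod (\<psi> x))\<^sup>2)"
      using assms by (simp add: L2_functions_def)
    show "(\<lambda>x. (cmod (\<phi> x + \<psi> x))\<^sup>2) \<in> borel_measurable lborel"
      using assms by (auto simp: L2_functions_def intro!: borel_measurable_power borel_measurable_norm borel_measurable_add)
    have "(cmod (p + q))\<^sup>2 \<le> 2 * (cmod p)\<^sup>2 + 2 * (cmod q)\<^sup>2" for p q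
    proof -
      have "(cmod (p + q))\<^sup>2 \<le> (cmod p + cmod q)\<^sup>2"
        by (simp add: norm_triangle_ineq)
      also have "\<dots> \<le> 2 * (cmod p)\<^sup>2 + 2 * (cmod q)\<^sup>2"
        using sum_squares_bound [of "cmod p" "cmod q"] by (simp add: power2_sum)
      finally show ?thesis .
    qed
    then show "AE x in lborel. norm ((cmod (\<phi> x + \<psi> x))\<^sup>2) \<le> norm (2 * (cmod (\<phi> x))\<^sup>2 + 2 * (cmod (\<psi> x))\<^sup>2)"
      by simp
  qed
  then show ?thesis
    using assms by (auto simp: L2_functions_def intro!: borel_measurable_add)
qed

lemma L2_functions_mult_left: "\<phi> \<in> L2_functions \<Longrightarrow> (\<lambda>x. c * \<phi> x) \<in> L2_functions"
  by (auto simp: L2_functions_def norm_mult power_mult_distrib intro!: borel_measurable_times)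

lemma bargmann_eq:
  fixes \<phi> :: "real^'n::finite \<Rightarrow> complex"
  assumes "\<phi> \<in> L2_functions"
  shows "bargmann \<phi> z = complex_of_real (pi powr (- real CARD('n) / 4)) * exp (- bil z z / 4) *
    (\<integral>x. half_gaussian z x * \<phi> x \<partial>lborel)"
  unfolding bargmann_def bargmann_kernel_eq using assms by (simp add: mult.assoc)

lemma bargmann_add:
  assumes "\<phi> \<in> L2_functions" "\<psi> \<in> L2_functions"
  shows "bargmann (\<lambda>x. \<phi> x + \<psi> x) z = bargmann \<phi> z + bargmann \<psi> z"
proof -
  have "integrable lborel (\<lambda>x. half_gaussian z x * \<phi> x)" "integrable lborel (\<lambda>x. half_gaussian z x * \<psi> x)"
    by (intro integrable_mult_L2 half_gaussian_in_L2 assms)+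
  then show ?thesis
    by (simp add: bargmann_eq assms L2_functions_add distrib_left)
qed

lemma bargmann_mult_left:
  assumes "\<phi> \<in> L2_functions"
  shows "bargmann (\<lambda>x. c * \<phi> x) z = c * bargmann \<phi> z"
  by (simp add: bargmann_eq assms L2_functions_mult_left mult.left_commute)

lemma bargmann_range_add:
  assumes "F \<in> bargmann ` L2_functions" "G \<in> bargmann ` L2_functions"
  shows "(\<lambda>z. F z + G z) \<in> bargmann ` L2_functions"
proof -
  obtain \<phi> \<psi> where "\<phi> \<in> L2_functions" "F = bargmann \<phi>" "\<psi> \<in> L2_functions" "G = bargmann \<psi>"
    using assms by blast
  then show ?thesis
    by (intro image_eqI [of _ _ "\<lambda>x. \<phi> x + \<psi> x"]) (simp_all add: fun_eq_iff bargmann_add L2_functions_add)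
qed

lemma bargmann_range_mult_left:
  assumes "F \<in> bargmann ` L2_functions"
  shows "(\<lambda>z. c * F z) \<in> bargmann ` L2_functions"
proof -
  obtain \<phi> where "\<phi> \<in> L2_functions" "F = bargmann \<phi>"
    using assms by blast
  then show ?thesis
    by (intro image_eqI [of _ _ "\<lambda>x. c * \<phi> x"]) (simp_all add: fun_eq_iff bargmann_mult_left L2_functions_mult_left)
qed

lemma bargmann_range_sum:
  fixes F :: "'i \<Rightarrow> complex^'n::finite \<Rightarrow> complex"
  assumes "finite I" "\<And>i. i \<in> I \<Longrightarrow> F i \<in> bargmann ` L2_functions"
  shows "(\<lambda>z. \<Sum>i\<in>I. F i z) \<in> bargmann ` L2_functions"
  using assms
proof (induction rule: finite_induct)
  case empty
  \<comment> \<open>The zero function is the transform of any square-integrable function, scaled by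
    0.\<close>
  show ?case
    using bargmann_range_mult_left [OF imageI, OF half_gaussian_in_L2(1), of 0] by simp
next
  case (insert i I)
  then show ?case
    by (simp add: bargmann_range_add)
qed

text \<open>The Gaussian integral contributes exp ((z + u)^2 / 4), whose part z^2 / 4 is cancelled
  by the factor exp (- z^2 / 4) of the transform. What remains is exp (u z / 2) times a constant
  free of z, and the moments are those of mean (z + u) / 2.\<close>

lemma bargmann_half_gaussian:
  fixes u :: "complex^'n::finite"
  obtains K where "K \<noteq> 0"
    and "\<And>z. bargmann (half_gaussian u) z = K * exp (bil u z / 2)"
    and "\<And>z j. bargmann (\<lambda>x. complex_of_real (x $ j) * half_gaussian u x) z =
      K * exp (bil u z / 2) * ((z $ j + u $ j) / 2)"
    and "\<And>z j k. bargmann (\<lambda>x. complex_of_real (x $ j) * complex_of_real (x $ k) * half_gaussian u x) z =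
      K * exp (bil u z / 2) * ((z $ j + u $ j) * (z $ k + u $ k) / 4 + (if j = k then 1 / 2 else 0))"
proof
  define K where "K = complex_of_real (pi powr (- real CARD('n) / 4)) *
    complex_of_real (sqrt pi ^ CARD('n)) * exp (bil u u / 4)"
  show "K \<noteq> 0"
    by (simp add: K_def)
  have mass: "complex_of_real (pi powr (- real CARD('n) / 4)) * exp (- bil z z / 4) *
      gaussian_mass (\<lambda>b::real^'n. bil (z + u) (cvec b)) = K * exp (bil u z / 2)" for z
  proof -
    have "exp (- bil z z / 4) * exp (bil (z + u) (z + u) / 4) = exp (bil u u / 4) * exp (bil u z / 2)"
    proof -
      have "- bil z z / 4 + bil (z + u) (z + u) / 4 = bil u u / 4 + bil u z / 2"
        by (simp add: bil_simps bil_commute [of z u] field_simps)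
      then show ?thesis
        by (simp only: exp_add [symmetric])
    qed
    then show ?thesis
      by (simp add: gaussian_mass_bil K_def)
  qed
  have axis: "axis i 1 \<in> (Basis :: (real^'n) set)" for i :: 'n
    by (simp add: axis_in_Basis_iff)
  let ?a = "\<lambda>z b. bil (z + u) (cvec b)"
  show "bargmann (half_gaussian u) z = K * exp (bil u z / 2)" for z
    using has_bochner_integral_gaussian [of "?a z"]
    by (simp add: bargmann_eq half_gaussian_in_L2 half_gaussian_mult mass [symmetric] has_bochner_integral_iff)
  show "bargmann (\<lambda>x. complex_of_real (x $ j) * half_gaussian u x) z =
      K * exp (bil u z / 2) * ((z $ j + u $ j) / 2)" for z j
    using has_bochner_integral_gaussian_1 [OF axis [of j], of "?a z"]
    by (simp add: bargmann_eq half_gaussian_in_L2 half_gaussian_mult mass [symmetric]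
        has_bochner_integral_iff mult.left_commute [of "half_gaussian z _"] inner_axis)
  show "bargmann (\<lambda>x. complex_of_real (x $ j) * complex_of_real (x $ k) * half_gaussian u x) z =
      K * exp (bil u z / 2) * ((z $ j + u $ j) * (z $ k + u $ k) / 4 + (if j = k then 1 / 2 else 0))" for z j k
  proof -
    have "(\<integral>x. half_gaussian z x * (complex_of_real (x $ j) * complex_of_real (x $ k) * half_gaussian u x) \<partial>lborel) =
        (\<integral>x. complex_of_real (x \<bullet> axis j 1) * complex_of_real (x \<bullet> axis k 1) * gaussian (?a z) x \<partial>lborel)"
      by (simp add: half_gaussian_mult [symmetric] inner_axis mult_ac)
    also have "\<dots> = gaussian_mass (?a z) * ((z $ j + u $ j) * (z $ k + u $ k) / 4 + (if j = k then 1 / 2 else 0))"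
      using has_bochner_integral_gaussian_2 [OF axis [of j] axis [of k], of "?a z"]
      unfolding has_bochner_integral_iff by (simp only: bil_cvec_axis vector_add_component axis_eq_axis) simp
    finally show ?thesis
      unfolding bargmann_eq [OF half_gaussian_in_L2(3)] mass [symmetric] by (simp only: mult.assoc)
  qed
qed

text \<open>The transforms of monomials times \<open>half_gaussian u\<close> have the wanted
  functions as leading terms, so the relations are triangular and are solved degree by
  degree.\<close>

lemma exp_bil_in_bargmann_range:
  fixes u :: "complex^'n::finite"
  shows "(\<lambda>z. exp (bil u z / 2)) \<in> bargmann ` L2_functions"
    and "(\<lambda>z. z $ j * exp (bil u z / 2)) \<in> bargmann ` L2_functions"
    and "(\<lambda>z. z $ j * z $ k * exp (bil u z / 2)) \<in> bargmann ` L2_functions"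
proof -
  obtain K where K: "K \<noteq> 0"
    and 0: "\<And>z. bargmann (half_gaussian u) z = K * exp (bil u z / 2)"
    and 1: "\<And>z j. bargmann (\<lambda>x. complex_of_real (x $ j) * half_gaussian u x) z =
      K * exp (bil u z / 2) * ((z $ j + u $ j) / 2)"
    and 2: "\<And>z j k. bargmann (\<lambda>x. complex_of_real (x $ j) * complex_of_real (x $ k) * half_gaussian u x) z =
      K * exp (bil u z / 2) * ((z $ j + u $ j) * (z $ k + u $ k) / 4 + (if j = k then 1 / 2 else 0))"
    by (rule bargmann_half_gaussian [of u], rule that)
  note range = half_gaussian_in_L2 [THEN imageI, of bargmann]
  show A0: "(\<lambda>z. exp (bil u z / 2)) \<in> bargmann ` L2_functions"
    using bargmann_range_mult_left [OF range(1) [of u], of "1 / K"] K by (simp add: 0)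
  have A1: "(\<lambda>z. z $ j * exp (bil u z / 2)) \<in> bargmann ` L2_functions" for j
  proof -
    have "(\<lambda>z. 2 / K * bargmann (\<lambda>x. complex_of_real (x $ j) * half_gaussian u x) z + - u $ j * exp (bil u z / 2))
        \<in> bargmann ` L2_functions"
      by (intro bargmann_range_add bargmann_range_mult_left range A0)
    also have "(\<lambda>z. 2 / K * bargmann (\<lambda>x. complex_of_real (x $ j) * half_gaussian u x) z +
        - u $ j * exp (bil u z / 2)) = (\<lambda>z. z $ j * exp (bil u z / 2))"
      unfolding 1 using K by (simp add: fun_eq_iff field_simps)
    finally show ?thesis .
  qed
  then show "(\<lambda>z. z $ j * exp (bil u z / 2)) \<in> bargmann ` L2_functions" .
  \<comment> \<open>Four times the second moment is (z_j + u_j) (z_k + u_k), plus 2 if j = k; the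
    correction removes everything but z_j z_k.\<close>
  let ?c = "- (u $ j * u $ k) - (if j = k then 2 else 0)"
  have "(\<lambda>z. 4 / K * bargmann (\<lambda>x. complex_of_real (x $ j) * complex_of_real (x $ k) * half_gaussian u x) z +
      (- u $ k * (z $ j * exp (bil u z / 2)) + (- u $ j * (z $ k * exp (bil u z / 2)) + ?c * exp (bil u z / 2))))
      \<in> bargmann ` L2_functions"
    by (intro bargmann_range_add bargmann_range_mult_left range A0 A1)
  also have "(\<lambda>z. 4 / K * bargmann (\<lambda>x. complex_of_real (x $ j) * complex_of_real (x $ k) * half_gaussian u x) z +
      (- u $ k * (z $ j * exp (bil u z / 2)) + (- u $ j * (z $ k * exp (bil u z / 2)) + ?c * exp (bil u z / 2)))) =
      (\<lambda>z. z $ j * z $ k * exp (bil u z / 2))"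
    unfolding 2 using K by (auto simp: fun_eq_iff field_simps)
  finally show "(\<lambda>z. z $ j * z $ k * exp (bil u z / 2)) \<in> bargmann ` L2_functions" .
qed

text \<open>As functions of z, the images of coherent states under \<open>d_metaplectic Y\<close>
  have this shape.\<close>

lemma quadratic_exp_bil_in_bargmann_range:
  fixes u l :: "complex^'n::finite" and M :: "complex^'n^'n"
  shows "(\<lambda>z. (c + bil l z + bil z (M *v z)) * exp (bil u z / 2)) \<in> bargmann ` L2_functions"
proof -
  have "(\<lambda>z. c * exp (bil u z / 2) + ((\<Sum>j\<in>UNIV. l $ j * (z $ j * exp (bil u z / 2))) +
      (\<Sum>j\<in>UNIV. \<Sum>k\<in>UNIV. M $ j $ k * (z $ j * z $ k * exp (bil u z / 2))))) \<in> bargmann ` L2_functions"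
    by (intro bargmann_range_add bargmann_range_mult_left bargmann_range_sum exp_bil_in_bargmann_range finite)
  also have "(\<lambda>z. c * exp (bil u z / 2) + ((\<Sum>j\<in>UNIV. l $ j * (z $ j * exp (bil u z / 2))) +
      (\<Sum>j\<in>UNIV. \<Sum>k\<in>UNIV. M $ j $ k * (z $ j * z $ k * exp (bil u z / 2))))) =
    (\<lambda>z. (c + bil l z + bil z (M *v z)) * exp (bil u z / 2))"
  proof
    fix z
    define E where "E = exp (bil u z / 2)"
    show "c * exp (bil u z / 2) + ((\<Sum>j\<in>UNIV. l $ j * (z $ j * exp (bil u z / 2))) +
      (\<Sum>j\<in>UNIV. \<Sum>k\<in>UNIV. M $ j $ k * (z $ j * z $ k * exp (bil u z / 2)))) =
      (c + bil l z + bil z (M *v z)) * exp (bil u z / 2)"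
      unfolding E_def [symmetric]
      by (simp add: bil_def matrix_vector_mult_def sum_distrib_left sum_distrib_right algebra_simps)
  qed
  finally show ?thesis .
qed

section \<open>Rotations and the reproducing property\<close>

text \<open>For each fixed second component the map is a translation, so Fubini reduces the claim to
  translation invariance; \<open>L\<close> may be any Borel map.\<close>

lemma distr_lborel_translation_fst:
  fixes L :: "'b::euclidean_space \<Rightarrow> 'a::euclidean_space"
  assumes [measurable]: "L \<in> borel \<rightarrow>\<^sub>M borel"
  shows "distr (lborel \<Otimes>\<^sub>M lborel) (lborel \<Otimes>\<^sub>M lborel) (\<lambda>(x, y). (L y + x, y)) = lborel \<Otimes>\<^sub>M lborel"
proof (rule measure_eqI)
  fix A :: "('a \<times> 'b) set"
  assume "A \<in> sets (distr (lborel \<Otimes>\<^sub>M lborel) (lborel \<Otimes>\<^sub>M lborel) (\<lambda>(x, y). (L y + x, y)))"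
  then have A [measurable]: "A \<in> sets (borel \<Otimes>\<^sub>M borel)"
    by simp
  have "emeasure (distr (lborel \<Otimes>\<^sub>M lborel) (lborel \<Otimes>\<^sub>M lborel) (\<lambda>(x, y). (L y + x, y))) A =
      (\<integral>\<^sup>+p. indicator A p \<partial>distr (lborel \<Otimes>\<^sub>M lborel) (lborel \<Otimes>\<^sub>M lborel) (\<lambda>(x, y). (L y + x, y)))"
    by (simp add: nn_integral_indicator)
  also have "\<dots> = (\<integral>\<^sup>+p. indicator A ((\<lambda>(x, y). (L y + x, y)) p) \<partial>(lborel \<Otimes>\<^sub>M lborel))"
    by (rule nn_integral_distr) simp_all
  also have "\<dots> = (\<integral>\<^sup>+y. \<integral>\<^sup>+x. indicator A (L y + x, y) \<partial>lborel \<partial>lborel)"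
    by (subst lborel_pair.nn_integral_snd [symmetric]) simp_all
  also have "\<dots> = (\<integral>\<^sup>+y. \<integral>\<^sup>+x. indicator A (x, y) \<partial>lborel \<partial>lborel)"
  proof (rule nn_integral_cong)
    fix y :: 'b
    have "(\<integral>\<^sup>+x. indicator A (x, y) \<partial>distr lborel borel ((+) (L y))) = (\<integral>\<^sup>+x. indicator A (L y + x, y) \<partial>lborel)"
      by (subst nn_integral_distr) simp_all
    then show "(\<integral>\<^sup>+x. indicator A (L y + x, y) \<partial>lborel) = (\<integral>\<^sup>+x. indicator A (x, y) \<partial>lborel)"
      by (simp add: lborel_distr_plus)
  qed
  also have "\<dots> = (\<integral>\<^sup>+p. indicator A p \<partial>(lborel \<Otimes>\<^sub>M lborel))"
    by (subst lborel_pair.nn_integral_snd [symmetric]) simp_all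
  also have "\<dots> = emeasure (lborel \<Otimes>\<^sub>M lborel) A"
    by (simp add: nn_integral_indicator)
  finally show "emeasure (distr (lborel \<Otimes>\<^sub>M lborel) (lborel \<Otimes>\<^sub>M lborel) (\<lambda>(x, y). (L y + x, y))) A =
      emeasure (lborel \<Otimes>\<^sub>M lborel) A" .
qed simp

lemma distr_lborel_translation_snd:
  fixes L :: "'a::euclidean_space \<Rightarrow> 'b::euclidean_space"
  assumes [measurable]: "L \<in> borel \<rightarrow>\<^sub>M borel"
  shows "distr (lborel \<Otimes>\<^sub>M lborel) (lborel \<Otimes>\<^sub>M lborel) (\<lambda>(x, y). (x, L x + y)) = lborel \<Otimes>\<^sub>M lborel"
proof (rule measure_eqI)
  fix A :: "('a \<times> 'b) set"
  assume "A \<in> sets (distr (lborel \<Otimes>\<^sub>M lborel) (lborel \<Otimes>\<^sub>M lborel) (\<lambda>(x, y). (x, L x + y)))"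
  then have A [measurable]: "A \<in> sets (borel \<Otimes>\<^sub>M borel)"
    by simp
  have "emeasure (distr (lborel \<Otimes>\<^sub>M lborel) (lborel \<Otimes>\<^sub>M lborel) (\<lambda>(x, y). (x, L x + y))) A =
      (\<integral>\<^sup>+p. indicator A p \<partial>distr (lborel \<Otimes>\<^sub>M lborel) (lborel \<Otimes>\<^sub>M lborel) (\<lambda>(x, y). (x, L x + y)))"
    by (simp add: nn_integral_indicator)
  also have "\<dots> = (\<integral>\<^sup>+p. indicator A ((\<lambda>(x, y). (x, L x + y)) p) \<partial>(lborel \<Otimes>\<^sub>M lborel))"
    by (rule nn_integral_distr) simp_all
  also have "\<dots> = (\<integral>\<^sup>+x. \<integral>\<^sup>+y. indicator A (x, L x + y) \<partial>lborel \<partial>lborel)"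
    by (subst lborel.nn_integral_fst [symmetric]) simp_all
  also have "\<dots> = (\<integral>\<^sup>+x. \<integral>\<^sup>+y. indicator A (x, y) \<partial>lborel \<partial>lborel)"
  proof (rule nn_integral_cong)
    fix x :: 'a
    have "(\<integral>\<^sup>+y. indicator A (x, y) \<partial>distr lborel borel ((+) (L x))) = (\<integral>\<^sup>+y. indicator A (x, L x + y) \<partial>lborel)"
      by (subst nn_integral_distr) simp_all
    then show "(\<integral>\<^sup>+y. indicator A (x, L x + y) \<partial>lborel) = (\<integral>\<^sup>+y. indicator A (x, y) \<partial>lborel)"
      by (simp add: lborel_distr_plus)
  qed
  also have "\<dots> = (\<integral>\<^sup>+p. indicator A p \<partial>(lborel \<Otimes>\<^sub>M lborel))"
    by (subst lborel.nn_integral_fst [symmetric]) simp_all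
  also have "\<dots> = emeasure (lborel \<Otimes>\<^sub>M lborel) A"
    by (simp add: nn_integral_indicator)
  finally show "emeasure (distr (lborel \<Otimes>\<^sub>M lborel) (lborel \<Otimes>\<^sub>M lborel) (\<lambda>(x, y). (x, L x + y))) A =
      emeasure (lborel \<Otimes>\<^sub>M lborel) A" .
qed simp

text \<open>A rotation by an angle other than $\pi$ is a product of three shears.\<close>

lemma distr_lborel_rotation:
  fixes c s :: real
  assumes "c\<^sup>2 + s\<^sup>2 = 1"
  shows "distr (lborel \<Otimes>\<^sub>M lborel) (lborel \<Otimes>\<^sub>M lborel)
      (\<lambda>(x, y :: 'a::euclidean_space). (c *\<^sub>R x - s *\<^sub>R y, s *\<^sub>R x + c *\<^sub>R y)) = lborel \<Otimes>\<^sub>M lborel"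
proof -
  let ?M = "lborel \<Otimes>\<^sub>M lborel :: ('a \<times> 'a) measure"
  let ?R = "\<lambda>c s (x, y :: 'a). (c *\<^sub>R x - s *\<^sub>R y, s *\<^sub>R x + c *\<^sub>R y)"
  have meas: "?R c s \<in> ?M \<rightarrow>\<^sub>M ?M" for c s
    by (simp add: split_beta)
  have shears: "distr ?M ?M (?R c s) = ?M" if "c\<^sup>2 + s\<^sup>2 = 1" "c \<noteq> -1" for c s :: real
  proof -
    \<comment> \<open>With c and s the cosine and sine of an angle, t is the tangent of half that
      angle, and the shears have coefficients - t, s, - t.\<close>
    define t where "t = s / (1 + c)"
    have nz: "1 + c \<noteq> 0"
      using that(2) by auto
    have t: "t * (1 + c) = s"
      using nz by (simp add: t_def)
    have "(1 + c) * (1 - s * t) = (1 + c) * c"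
      using that(1) t by (simp add: algebra_simps power2_eq_square)
    then have st: "1 - s * t = c"
      using nz by (simp only: mult_cancel_left) simp
    let ?S = "\<lambda>(x, y :: 'a). ((- t) *\<^sub>R y + x, y)" and ?S' = "\<lambda>(x :: 'a, y). (x, s *\<^sub>R x + y)"
    have S_meas: "?S \<in> ?M \<rightarrow>\<^sub>M ?M" and S'_meas: "?S' \<in> ?M \<rightarrow>\<^sub>M ?M"
      by (simp_all add: split_beta)
    have S: "distr ?M ?M ?S = ?M"
      by (rule distr_lborel_translation_fst) simp
    have S': "distr ?M ?M ?S' = ?M"
      by (rule distr_lborel_translation_snd) simp
    have R_eq: "?R c s = ?S \<circ> (?S' \<circ> ?S)"
    proof
      fix p :: "'a \<times> 'a"
      obtain x y where p: "p = (x, y)"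
        by (cases p)
      have "c *\<^sub>R y = y - (s * t) *\<^sub>R y"
        using arg_cong [OF st, of "\<lambda>r. r *\<^sub>R y"] by (simp only: scaleR_diff_left scaleR_one)
      then have eq2: "s *\<^sub>R ((- t) *\<^sub>R y + x) + y = s *\<^sub>R x + c *\<^sub>R y"
        by (simp add: scaleR_diff_right)
      have x: "(1 - s * t) *\<^sub>R x = x - t *\<^sub>R s *\<^sub>R x"
        by (simp only: scaleR_diff_left scaleR_one scaleR_scaleR mult.commute)
      have y: "(t * (1 + c)) *\<^sub>R y = t *\<^sub>R y + t *\<^sub>R c *\<^sub>R y"
        by (simp only: distrib_left scaleR_add_left mult_1_right scaleR_scaleR)
      have "(- t) *\<^sub>R (s *\<^sub>R x + c *\<^sub>R y) + ((- t) *\<^sub>R y + x) = (1 - s * t) *\<^sub>R x - (t * (1 + c)) *\<^sub>R y"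
        unfolding x y by (simp only: scaleR_minus_left scaleR_add_right minus_add_distrib diff_conv_add_uminus add_ac)
      then have eq1: "(- t) *\<^sub>R (s *\<^sub>R x + c *\<^sub>R y) + ((- t) *\<^sub>R y + x) = c *\<^sub>R x - s *\<^sub>R y"
        unfolding st t .
      show "?R c s p = (?S \<circ> (?S' \<circ> ?S)) p"
        by (simp only: p o_apply prod.case eq2 eq1)
    qed
    have "distr ?M ?M (?R c s) = distr (distr ?M ?M (?S' \<circ> ?S)) ?M ?S"
      by (subst R_eq, rule distr_distr [OF S_meas measurable_comp [OF S_meas S'_meas], symmetric])
    also have "distr ?M ?M (?S' \<circ> ?S) = distr (distr ?M ?M ?S) ?M ?S'"
      by (rule distr_distr [OF S'_meas S_meas, symmetric])
    finally show ?thesis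
      unfolding S S' .
  qed
  show ?thesis
  proof (cases "c = -1")
    \<comment> \<open>The half turn, for which the half-angle tangent is infinite, is the square of
      a quarter turn.\<close>
    case True
    then have "s = 0"
      using assms by simp
    then have "?R c s = ?R 0 1 \<circ> ?R 0 1"
      using True by (auto simp: fun_eq_iff)
    then have "distr ?M ?M (?R c s) = distr (distr ?M ?M (?R 0 1)) ?M (?R 0 1)"
      by (simp only: distr_distr [OF meas meas])
    also have "distr ?M ?M (?R 0 1) = ?M"
      by (rule shears) simp_all
    finally show ?thesis
      using shears [of 0 1] by simp
  next
    case False
    then show ?thesis
      by (rule shears [OF assms])
  qed
qed

section \<open>Lebesgue measure on complex vectors and its invariance under phases\<close>

lemma Basis_complex_vec:
  "(Basis :: (complex^'n::finite) set) = range (\<lambda>j. axis j 1) \<union> range (\<lambda>j. axis j \<i>)"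
  by (auto simp: Basis_vec_def Basis_complex_def)

lemma prod_Basis_complex_vec:
  fixes f :: "complex^'n::finite \<Rightarrow> 'b::comm_monoid_mult"
  shows "(\<Prod>b\<in>Basis. f b) = (\<Prod>j\<in>UNIV. f (axis j 1)) * (\<Prod>j\<in>UNIV. f (axis j \<i>))"
proof -
  have "range (\<lambda>j::'n. axis j 1) \<inter> range (\<lambda>j::'n. axis j \<i>) = {}"
    by (auto simp: axis_eq_axis)
  moreover have "prod f (range (\<lambda>j. axis j 1)) = (\<Prod>j\<in>UNIV. f (axis j 1))"
    by (subst prod.reindex) (auto simp: inj_on_def axis_eq_axis)
  moreover have "prod f (range (\<lambda>j. axis j \<i>)) = (\<Prod>j\<in>UNIV. f (axis j \<i>))"
    by (subst prod.reindex) (auto simp: inj_on_def axis_eq_axis)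
  ultimately show ?thesis
    by (simp add: Basis_complex_vec prod.union_disjoint)
qed

lemma prod_Basis_real_vec:
  fixes f :: "real^'n::finite \<Rightarrow> 'b::comm_monoid_mult"
  shows "(\<Prod>b\<in>Basis. f b) = (\<Prod>j\<in>UNIV. f (axis j 1))"
proof -
  have "(Basis :: (real^'n) set) = range (\<lambda>j. axis j 1)"
    by (auto simp: Basis_vec_def)
  moreover have "prod f (range (\<lambda>j. axis j 1)) = (\<Prod>j\<in>UNIV. f (axis j 1))"
    by (subst prod.reindex) (auto simp: inj_on_def axis_eq_axis)
  ultimately show ?thesis
    by simp
qed

definition complex_of_pair :: "(real^'n::finite) \<times> (real^'n) \<Rightarrow> complex^'n" where
  "complex_of_pair = (\<lambda>(x, y). cvec x + \<i> *s cvec y)"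

lemma measurable_complex_of_pair [measurable]: "complex_of_pair \<in> borel \<rightarrow>\<^sub>M borel"
proof (rule borel_measurable_continuous_onI)
  have "continuous_on UNIV (\<lambda>p :: (real^'n) \<times> (real^'n). \<chi> j. complex_of_real (fst p $ j) + \<i> * complex_of_real (snd p $ j))"
    by (intro continuous_intros)
  then show "continuous_on UNIV (complex_of_pair :: (real^'n) \<times> (real^'n) \<Rightarrow> complex^'n)"
    by (simp add: complex_of_pair_def split_beta cvec_def vector_scalar_mult_def plus_vec_def)
qed

text \<open>Lebesgue measure is determined by its values on boxes, and a complex box pulls back to a
  product of a box of real parts and a box of imaginary parts.\<close>

lemma lborel_eq_distr_complex_of_pair:
  "(lborel :: (complex^'n::finite) measure) = distr (lborel \<Otimes>\<^sub>M lborel) borel complex_of_pair"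
proof (rule lborel_eqI)
  fix l u :: "complex^'n"
  assume le: "\<And>b. b \<in> Basis \<Longrightarrow> l \<bullet> b \<le> u \<bullet> b"
  define lr li ur ui where "lr = (\<chi> j. Re (l $ j))" "li = (\<chi> j. Im (l $ j))"
    "ur = (\<chi> j. Re (u $ j))" "ui = (\<chi> j. Im (u $ j))"
  note defs = this
  have le': "Re (l $ j) \<le> Re (u $ j)" "Im (l $ j) \<le> Im (u $ j)" for j
    using le [of "axis j 1"] le [of "axis j \<i>"]
    by (simp_all add: axis_complex_in_Basis inner_axis inner_complex_def)
  have "w \<in> box l u \<longleftrightarrow> (\<forall>j. Re (l $ j) < Re (w $ j) \<and> Re (w $ j) < Re (u $ j)) \<and>
      (\<forall>j. Im (l $ j) < Im (w $ j) \<and> Im (w $ j) < Im (u $ j))" for w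
    unfolding mem_box Basis_complex_vec ball_Un ball_simps by (simp add: inner_axis inner_complex_def)
  then have "complex_of_pair -` box l u = box lr ur \<times> box li ui"
    by (auto simp: complex_of_pair_def mem_box_cart cvec_def defs)
  then have "emeasure (distr (lborel \<Otimes>\<^sub>M lborel) borel complex_of_pair) (box l u) =
      emeasure (lborel \<Otimes>\<^sub>M lborel) (box lr ur \<times> box li ui)"
    by (subst emeasure_distr) (simp_all add: lborel_prod)
  also have "\<dots> = emeasure lborel (box lr ur) * emeasure lborel (box li ui)"
    by (rule lborel.emeasure_pair_measure_Times) simp_all
  also have "emeasure lborel (box lr ur) = ennreal (\<Prod>b\<in>Basis. (ur - lr) \<bullet> b)"
    by (rule emeasure_lborel_box) (auto simp: Basis_vec_def inner_axis defs le')
  also have "emeasure lborel (box li ui) = ennreal (\<Prod>b\<in>Basis. (ui - li) \<bullet> b)"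
    by (rule emeasure_lborel_box) (auto simp: Basis_vec_def inner_axis defs le')
  also have "ennreal (\<Prod>b\<in>Basis. (ur - lr) \<bullet> b) * ennreal (\<Prod>b\<in>Basis. (ui - li) \<bullet> b) =
      ennreal (\<Prod>b\<in>Basis. (u - l) \<bullet> b)"
    unfolding prod_Basis_real_vec prod_Basis_complex_vec
    by (simp add: inner_axis inner_complex_def defs le' ennreal_mult [symmetric] prod_nonneg)
  finally show "emeasure (distr (lborel \<Otimes>\<^sub>M lborel) borel complex_of_pair) (box l u) =
      (\<Prod>b\<in>Basis. (u - l) \<bullet> b)" .
qed simp

lemma distr_lborel_cis:
  "distr lborel borel (\<lambda>w :: complex^'n::finite. cis t *s w) = lborel"
proof -
  let ?M = "lborel \<Otimes>\<^sub>M lborel :: ((real^'n) \<times> (real^'n)) measure"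
  let ?R = "\<lambda>(x, y :: real^'n). (cos t *\<^sub>R x - sin t *\<^sub>R y, sin t *\<^sub>R x + cos t *\<^sub>R y)"
  have rot [measurable]: "(\<lambda>w :: complex^'n. cis t *s w) \<in> borel \<rightarrow>\<^sub>M borel"
    by (intro borel_measurable_continuous_onI) (simp add: vector_scalar_mult_def, intro continuous_intros)
  have R [measurable]: "?R \<in> ?M \<rightarrow>\<^sub>M ?M"
    by (simp add: split_beta)
  have pair [measurable]: "complex_of_pair \<in> ?M \<rightarrow>\<^sub>M borel"
    by (simp add: lborel_prod)
  \<comment> \<open>Multiplication by a phase is a plane rotation applied to real and imaginary
    parts in all coordinates simultaneously.\<close>
  have comm: "(\<lambda>w. cis t *s w) \<circ> complex_of_pair = complex_of_pair \<circ> ?R"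
    by (auto simp: fun_eq_iff vec_eq_iff complex_of_pair_def cvec_def complex_eq_iff)
  have "distr lborel borel (\<lambda>w :: complex^'n. cis t *s w) = distr ?M borel ((\<lambda>w. cis t *s w) \<circ> complex_of_pair)"
    by (subst lborel_eq_distr_complex_of_pair) (simp add: distr_distr)
  also have "\<dots> = distr (distr ?M ?M ?R) borel complex_of_pair"
    unfolding comm by (rule distr_distr [symmetric, OF pair R])
  also have "distr ?M ?M ?R = ?M"
    by (rule distr_lborel_rotation) simp
  finally show ?thesis
    by (simp flip: lborel_eq_distr_complex_of_pair)
qed

section \<open>Averages of entire functions over circles\<close>

lemma circle_mean_value:
  assumes "f holomorphic_on UNIV"
  shows "(\<integral>t. indicator {0..1} t *\<^sub>R f (cis (2 * pi * t)) \<partial>lborel) = f 0"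
proof -
  have cont: "continuous_on UNIV f"
    using assms by (rule holomorphic_on_imp_continuous_on)
  \<comment> \<open>Cauchy's formula at the centre: the velocity on the unit circle is 2 pi i u,
    which cancels the denominator and leaves an average over t.\<close>
  have "((\<lambda>u. f u / (u - 0)) has_contour_integral (2 * of_real pi * \<i> * f 0)) (circlepath 0 1)"
    by (rule Cauchy_integral_circlepath_simple) (auto intro: holomorphic_on_subset [OF assms])
  then have "((\<lambda>t. 2 * of_real pi * \<i> * f (cis (2 * pi * t))) has_integral 2 * of_real pi * \<i> * f 0) {0..1}"
    unfolding has_contour_integral_def
  proof (rule has_integral_eq [rotated])
    fix t :: real
    assume "t \<in> {0..1}"
    then have "vector_derivative (circlepath 0 1) (at t within {0..1}) = 2 * of_real pi * \<i> * cis (2 * pi * t)"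
      using vector_derivative_circlepath01 [of t 0 1] by (simp add: cis_conv_exp mult_ac)
    moreover have "circlepath 0 1 t = cis (2 * pi * t)"
      by (simp add: circlepath cis_conv_exp mult_ac)
    ultimately show "f (circlepath 0 1 t) / (circlepath 0 1 t - 0) *
        vector_derivative (circlepath 0 1) (at t within {0..1}) = 2 * of_real pi * \<i> * f (cis (2 * pi * t))"
      by simp
  qed
  then have "((\<lambda>t. inverse (2 * of_real pi * \<i>) * (2 * of_real pi * \<i> * f (cis (2 * pi * t)))) has_integral
      inverse (2 * of_real pi * \<i>) * (2 * of_real pi * \<i> * f 0)) {0..1}"
    by (rule has_integral_mult_right)
  then have "((\<lambda>t. f (cis (2 * pi * t))) has_integral f 0) {0..1}"
    by (simp add: field_simps)
  moreover have "set_integrable lborel {0..1} (\<lambda>t. f (cis (2 * pi * t)))"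
    by (intro borel_integrable_atLeastAtMost' continuous_on_compose2 [OF cont] continuous_intros) auto
  ultimately show ?thesis
    using set_borel_integral_eq_integral(2) integral_unique unfolding set_lebesgue_integral_def
    by metis
qed

lemma integral_lborel_cis:
  fixes f :: "complex^'n::finite \<Rightarrow> complex"
  assumes "f \<in> borel_measurable borel"
  shows "(\<integral>w. f (cis t *s w) \<partial>lborel) = integral\<^sup>L lborel f"
proof -
  have "(\<lambda>w :: complex^'n. cis t *s w) \<in> borel \<rightarrow>\<^sub>M borel"
    by (intro borel_measurable_continuous_onI) (simp add: vector_scalar_mult_def, intro continuous_intros)
  then have "integral\<^sup>L (distr lborel borel (\<lambda>w. cis t *s w)) f = (\<integral>w. f (cis t *s w) \<partial>lborel)"
    by (intro integral_distr assms) simp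
  then show ?thesis
    by (simp add: distr_lborel_cis)
qed

lemma integrable_exp_norm:
  fixes c :: real
  assumes "c > 0"
  shows "integrable lborel (\<lambda>w :: 'a::euclidean_space. exp (- c * (norm w)\<^sup>2))"
  using integrable_norm [OF integrable_moment_exp_quadratic [OF assms, of "\<lambda>_ :: 'a. 0" "\<lambda>_. 0"]]
  by (simp add: power2_norm_eq_inner)

lemma integral_mu_eq:
  fixes f :: "complex^'n::finite \<Rightarrow> complex"
  assumes "f \<in> borel_measurable borel"
  shows "integral\<^sup>L mu f = integral\<^sup>L lborel f / (2 * pi) ^ CARD('n)"
  unfolding mu_def using assms by (subst integral_density) (simp_all add: scaleR_conv_of_real)

text \<open>Averaging over the rotations \<open>w \<mapsto> cis t *s w\<close>, which preserve the Gaussian weight,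
  replaces \<open>H\<close> by its mean value over circles.\<close>

lemma integral_entire_gaussian:
  fixes H :: "complex^'n::finite \<Rightarrow> complex"
  assumes cont: "continuous_on UNIV H"
    and hol: "\<And>v. (\<lambda>c. H (c *s v)) holomorphic_on UNIV"
    and bound: "\<And>v. cmod (H v) \<le> B * exp ((norm v)\<^sup>2 / 4)"
  shows "(\<integral>w. H (cnj_vec w) * exp (- complex_of_real ((norm w)\<^sup>2) / 2) \<partial>mu) = H 0"
proof -
  define G where "G w = exp (- complex_of_real ((norm w)\<^sup>2) / 2)" for w :: "complex^'n"
  \<comment> \<open>The integrand rotated by the angle 2 pi t. Integrating over w first gives the
    wanted integral for each t, integrating over t first gives the value of \<open>H\<close> at
    0.\<close>
  define f where "f = (\<lambda>(t, w). indicator {0..1} t *\<^sub>R (H (cis (2 * pi * t) *s cnj_vec w) * G w))"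
  have cont_cnj: "continuous_on UNIV (cnj_vec :: complex^'n \<Rightarrow> complex^'n)"
    unfolding cnj_vec_def by (intro continuous_intros)
  have cont_cis: "continuous_on UNIV (\<lambda>p. cis (2 * pi * fst p) *s cnj_vec (snd p) :: complex^'n)"
    unfolding vector_scalar_mult_def cnj_vec_def by (intro continuous_intros)
  have cont_G: "continuous_on UNIV G"
    unfolding G_def by (intro continuous_intros) auto
  have norm_cnj: "norm (cnj_vec w) = norm w" for w :: "complex^'n"
    by (simp add: norm_vec_def cnj_vec_def)
  have norm_cis: "norm (cis t *s w) = norm w" for t and w :: "complex^'n"
    by (simp add: norm_vec_def norm_mult)
  \<comment> \<open>Growth of order exp (|v|^2 / 4) uses half of the decay of the weight; the
    remaining majorant does not depend on the angle, which is what Fubini needs.\<close>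
  have bound_G: "cmod (H v * G w) \<le> B * exp (- (1 / 4) * (norm w)\<^sup>2)" if "norm v = norm w" for v w
  proof -
    have "cmod (H v * G w) \<le> B * exp ((norm w)\<^sup>2 / 4) * exp (- (norm w)\<^sup>2 / 2)"
      using mult_right_mono [OF bound [of v], of "exp (- (norm w)\<^sup>2 / 2)"] that
      by (simp add: norm_mult G_def)
    also have "\<dots> = B * exp (- (1 / 4) * (norm w)\<^sup>2)"
      by (simp add: mult.assoc flip: exp_add)
    finally show ?thesis .
  qed
  have HG_measurable: "(\<lambda>w. H (cnj_vec w) * G w) \<in> borel_measurable borel"
    by (intro borel_measurable_continuous_onI continuous_intros continuous_on_compose2 [OF cont]
        cont_cnj cont_G) auto
  have "(\<lambda>p. H (cis (2 * pi * fst p) *s cnj_vec (snd p)) * G (snd p)) \<in> borel_measurable borel"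
    by (intro borel_measurable_continuous_onI continuous_intros continuous_on_compose2 [OF cont]
        continuous_on_compose2 [OF cont_G] cont_cis) auto
  then have [measurable]: "f \<in> borel_measurable (lborel \<Otimes>\<^sub>M lborel)"
    unfolding f_def split_beta lborel_prod by (intro borel_measurable_scaleR) (auto simp: borel_prod [symmetric])
  have "integrable (lborel \<Otimes>\<^sub>M lborel) f"
  proof (rule Bochner_Integration.integrable_bound)
    show "integrable (lborel \<Otimes>\<^sub>M lborel)
        (\<lambda>(t :: real, w :: complex^'n). indicator {0..1} t * (B * exp (- (1 / 4) * (norm w)\<^sup>2)))"
    proof (rule lborel_pair.Fubini_integrable)
      show "(\<lambda>(t :: real, w :: complex^'n). indicator {0..1} t * (B * exp (- (1 / 4) * (norm w)\<^sup>2)))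
          \<in> borel_measurable (lborel \<Otimes>\<^sub>M lborel)"
        by (simp add: split_beta)
    qed (use integrable_exp_norm [of "1 / 4", where 'a = "complex^'n"] in
        \<open>auto simp: abs_mult integrable_real_mult_indicator\<close>)
    show "AE p in lborel \<Otimes>\<^sub>M lborel. norm (f p) \<le>
        norm ((\<lambda>(t :: real, w :: complex^'n). indicator {0..1} t * (B * exp (- (1 / 4) * (norm w)\<^sup>2))) p)"
      using order_trans [OF bound_G abs_ge_self]
      by (intro AE_I2) (auto simp: f_def split: split_indicator simp: norm_cis norm_cnj)
  qed simp
  then have swap: "(\<integral>w. (\<integral>t. f (t, w) \<partial>lborel) \<partial>lborel) = (\<integral>t. (\<integral>w. f (t, w) \<partial>lborel) \<partial>lborel)"
    by (intro lborel_pair.Fubini_integral) (simp add: split_beta)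
  have inner_w: "(\<integral>w. f (t, w) \<partial>lborel) = indicator {0..1} t *\<^sub>R (\<integral>w. H (cnj_vec w) * G w \<partial>lborel)" for t
  proof -
    \<comment> \<open>Conjugation reverses rotations, hence the negative angle.\<close>
    have "cnj_vec (cis (- (2 * pi * t)) *s w) = cis (2 * pi * t) *s cnj_vec w" for w :: "complex^'n"
      by (simp add: vec_eq_iff cnj_vec_def cis_cnj)
    moreover have "G (cis (- (2 * pi * t)) *s w) = G w" for w
      by (simp add: G_def norm_cis)
    ultimately show ?thesis
      using integral_lborel_cis [OF HG_measurable, of "- (2 * pi * t)"] by (simp add: f_def)
  qed
  have inner_t: "(\<integral>t. f (t, w) \<partial>lborel) = H 0 * G w" for w
  proof -
    have "(\<integral>t. f (t, w) \<partial>lborel) = (\<integral>t. indicator {0..1} t *\<^sub>R H (cis (2 * pi * t) *s cnj_vec w) \<partial>lborel) * G w"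
      by (subst integral_mult_left_zero [symmetric]) (simp add: f_def)
    then show ?thesis
      using circle_mean_value [OF hol [of "cnj_vec w"]] by simp
  qed
  have lborel_eq: "(\<integral>w. H (cnj_vec w) * G w \<partial>lborel) = H 0 * integral\<^sup>L lborel G"
    using swap unfolding inner_w inner_t by (subst (asm) integral_scaleR_left) simp_all
  \<comment> \<open>The mass of the weight is the constant by which \<open>mu\<close> is normalised,
    so no factor survives in front of \<open>H 0\<close>.\<close>
  have integral_G: "integral\<^sup>L lborel G = complex_of_real ((2 * pi) ^ CARD('n))"
  proof -
    have 1: "has_bochner_integral lborel (\<lambda>x. exp (- x\<^sup>2 / 2)) (sqrt (2 * pi))"
    proof -
      have "has_bochner_integral lborel (\<lambda>x. sqrt (2 * pi) * std_normal_density x) (sqrt (2 * pi) * 1)"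
        by (intro has_bochner_integral_mult_right) (simp add: has_bochner_integral_iff)
      then show ?thesis
        by (simp add: std_normal_density_def)
    qed
    then have "has_bochner_integral lborel (\<lambda>w :: complex^'n. \<Prod>b\<in>Basis. exp (- (w \<bullet> b)\<^sup>2 / 2))
        (\<Prod>b\<in>(Basis :: (complex^'n) set). sqrt (2 * pi))"
      using has_bochner_integral_lborel_prod [of "\<lambda>_ :: complex^'n. \<lambda>x. exp (- x\<^sup>2 / 2) :: real"]
      by (simp add: has_bochner_integral_iff)
    moreover have "(\<Prod>b\<in>Basis. exp (- (w \<bullet> b)\<^sup>2 / 2)) = exp (- (norm w)\<^sup>2 / 2)" for w :: "complex^'n"
      by (simp add: exp_sum [symmetric] sum_divide_distrib [symmetric] sum_negf power2_norm_eq_inner)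
        (simp add: euclidean_inner [of w w] power2_eq_square)
    ultimately have "(\<integral>w. exp (- (norm (w :: complex^'n))\<^sup>2 / 2) \<partial>lborel) = (2 * pi) ^ CARD('n)"
      by (simp add: has_bochner_integral_iff power_mult mult.commute [of _ 2])
    moreover have "G = (\<lambda>w. complex_of_real (exp (- (norm w)\<^sup>2 / 2)))"
      by (simp add: fun_eq_iff G_def exp_of_real [symmetric])
    ultimately show ?thesis
      by (simp only: integral_complex_of_real)
  qed
  show ?thesis
    using integral_mu_eq [OF HG_measurable] unfolding lborel_eq integral_G by (simp add: G_def)
qed

section \<open>The reproducing property for exponentials of quadratic polynomials\<close>

lemma integral_mu_translation:
  fixes f :: "complex^'n::finite \<Rightarrow> complex"
  assumes [measurable]: "f \<in> borel_measurable borel"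
  shows "(\<integral>w. f (a + w) \<partial>mu) = integral\<^sup>L mu f"
proof -
  have "integral\<^sup>L (distr lborel borel ((+) a)) f = (\<integral>w. f (a + w) \<partial>lborel)"
    by (rule integral_distr) simp_all
  then show ?thesis
    by (simp add: integral_mu_eq lborel_distr_plus)
qed

lemma cmod_bil_le: "cmod (bil l v) \<le> (\<Sum>j\<in>UNIV. cmod (l $ j)) * norm v"
proof -
  have "cmod (bil l v) \<le> (\<Sum>j\<in>UNIV. cmod (l $ j * v $ j))"
    unfolding bil_def by (rule norm_sum)
  also have "\<dots> \<le> (\<Sum>j\<in>UNIV. cmod (l $ j) * norm v)"
    by (intro sum_mono) (simp add: norm_mult mult_left_mono Finite_Cartesian_Product.norm_nth_le)
  finally show ?thesis
    by (simp add: sum_distrib_right)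
qed

lemma bil_transpose: "bil u (N *v v) = bil (transpose N *v u) v"
proof -
  have "bil u (N *v v) = (\<Sum>i\<in>UNIV. \<Sum>j\<in>UNIV. u $ i * (N $ i $ j * v $ j))"
    by (simp add: bil_def matrix_vector_mult_def sum_distrib_left)
  also have "\<dots> = (\<Sum>j\<in>UNIV. \<Sum>i\<in>UNIV. u $ i * (N $ i $ j * v $ j))"
    by (rule sum.swap)
  also have "\<dots> = bil (transpose N *v u) v"
    by (simp add: bil_def matrix_vector_mult_def transpose_def sum_distrib_left sum_distrib_right mult_ac)
  finally show ?thesis .
qed

text \<open>Turns the weight into an expression in \<open>bil\<close>, so that exponents can be
  shifted and compared by bilinearity alone.\<close>

lemma of_real_norm_squared: "complex_of_real ((norm w)\<^sup>2) = bil w (cnj_vec w)"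
  unfolding power2_norm_eq_inner inner_vec_def of_real_sum
  by (simp add: bil_def cnj_vec_def complex_norm_square dot_square_norm del: of_real_power)

lemma cnj_vec_simps [simp]:
  "cnj_vec (x + y) = cnj_vec x + cnj_vec y" "cnj_vec (cnj_vec x) = x"
  by (simp_all add: cnj_vec_def vec_eq_iff)

lemma continuous_on_cnj_vec [continuous_intros]:
  "continuous_on S f \<Longrightarrow> continuous_on S (\<lambda>x. cnj_vec (f x))"
  unfolding cnj_vec_def by (intro continuous_intros)

lemma continuous_on_matrix_vector_mult_complex [continuous_intros]:
  fixes N :: "complex^'n::finite^'m::finite"
  shows "continuous_on S f \<Longrightarrow> continuous_on S (\<lambda>x. N *v f x)"
  unfolding matrix_vector_mult_def by (intro continuous_intros)

text \<open>The mean value over circles is the value at 0, which is exp 0. The admissible growth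
  |v|^2 / 4 is split evenly: 1/8 for the quadratic part by assumption, 1/8 for absorbing the linear
  part.\<close>

lemma integral_exp_quadratic_cnj:
  fixes N :: "complex^'n::finite^'n" and l :: "complex^'n"
  assumes N: "\<And>v. cmod (bil v (N *v v)) \<le> (norm v)\<^sup>2 / 8"
  shows "(\<integral>w. exp (bil l (cnj_vec w) + bil (cnj_vec w) (N *v cnj_vec w)) *
    exp (- complex_of_real ((norm w)\<^sup>2) / 2) \<partial>mu) = 1"
proof -
  define H where "H v = exp (bil l v + bil v (N *v v))" for v
  define K where "K = (\<Sum>j\<in>UNIV. cmod (l $ j))"
  have "(\<integral>w. H (cnj_vec w) * exp (- complex_of_real ((norm w)\<^sup>2) / 2) \<partial>mu) = H 0"
  proof (rule integral_entire_gaussian)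
    show "continuous_on UNIV H"
      unfolding H_def by (intro continuous_intros)
    show "(\<lambda>c. H (c *s v)) holomorphic_on UNIV" for v
      unfolding H_def by (simp add: bil_simps vector_scalar_commute) (intro holomorphic_intros)
    show "cmod (H v) \<le> exp (2 * K\<^sup>2) * exp ((norm v)\<^sup>2 / 4)" for v
    proof -
      have "cmod (bil l v) \<le> K * norm v"
        unfolding K_def by (rule cmod_bil_le)
      moreover have "K * norm v \<le> 2 * K\<^sup>2 + (norm v)\<^sup>2 / 8"
        using zero_le_power2 [of "4 * K - norm v"] by (simp add: power2_eq_square algebra_simps)
      moreover have "Re (bil l v + bil v (N *v v)) \<le> cmod (bil l v) + cmod (bil v (N *v v))"
        by (simp add: add_mono complex_Re_le_cmod)
      ultimately have "Re (bil l v + bil v (N *v v)) \<le> 2 * K\<^sup>2 + (norm v)\<^sup>2 / 4"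
        using N [of v] by linarith
      then show ?thesis
        by (simp add: H_def flip: exp_add)
    qed
  qed
  then show ?thesis
    by (simp add: H_def bil_simps)
qed

text \<open>Substitute \<open>cnj_vec u + v\<close> for the integration variable. The holomorphic
  term u v / 2 then cancels against the one from the weight, so apart from the Gaussian weight only
  conjugates of v remain, and the previous integral applies with a new linear coefficient.\<close>

lemma reproducing_exp_quadratic:
  fixes N :: "complex^'n::finite^'n" and l u :: "complex^'n"
  assumes N: "\<And>v. cmod (bil v (N *v v)) \<le> (norm v)\<^sup>2 / 8"
  shows "(\<integral>w. exp (bil l (cnj_vec w) + bil (cnj_vec w) (N *v cnj_vec w)) * exp (bil u w / 2) *
    exp (- complex_of_real ((norm w)\<^sup>2) / 2) \<partial>mu) = exp (bil l u + bil u (N *v u))"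
proof -
  define f where "f w = exp (bil l (cnj_vec w) + bil (cnj_vec w) (N *v cnj_vec w)) * exp (bil u w / 2) *
    exp (- complex_of_real ((norm w)\<^sup>2) / 2)" for w
  \<comment> \<open>The terms \<open>N *v u\<close> and \<open>transpose N *v u\<close> come from
    expanding the quadratic form at the shifted point, the last one from the weight.\<close>
  define l' where "l' = l + N *v u + transpose N *v u - (1 / 2) *s cnj_vec u"
  have shift: "f (cnj_vec u + v) = exp (bil l u + bil u (N *v u)) *
      (exp (bil l' (cnj_vec v) + bil (cnj_vec v) (N *v cnj_vec v)) * exp (- complex_of_real ((norm v)\<^sup>2) / 2))" for v
    unfolding f_def of_real_norm_squared exp_add [symmetric]
    by (rule arg_cong [of _ _ exp])
      (simp add: bil_simps l'_def matrix_vector_right_distrib bil_transpose [symmetric]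
        bil_commute [of _ u] bil_commute [of "N *v u"] field_simps del: transpose_matrix_vector)
  have "continuous_on UNIV f"
    unfolding f_def by (intro continuous_intros) auto
  then have "integral\<^sup>L mu f = (\<integral>v. f (cnj_vec u + v) \<partial>mu)"
    by (intro integral_mu_translation [symmetric] borel_measurable_continuous_onI)
  also have "(\<integral>v. f (cnj_vec u + v) \<partial>mu) = (\<integral>v. exp (bil l u + bil u (N *v u)) *
      (exp (bil l' (cnj_vec v) + bil (cnj_vec v) (N *v cnj_vec v)) * exp (- complex_of_real ((norm v)\<^sup>2) / 2)) \<partial>mu)"
    by (simp only: shift)
  also have "\<dots> = exp (bil l u + bil u (N *v u))"
    by (simp only: integral_mult_right_zero integral_exp_quadratic_cnj [OF N] mult_1_right)
  finally show ?thesis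
    unfolding f_def .
qed

section \<open>Derivatives of matrix-valued functions\<close>

text \<open>Matrix multiplication is bilinear in finite dimension; submultiplicativity up to a
  constant is enough for the exponential series.\<close>

lemma norm_matrix_matrix_mult_bound:
  obtains K where "K > 0" and "\<And>(M :: complex^'m::finite^'m) (N :: complex^'m^'m). norm (M ** N) \<le> K * norm M * norm N"
proof -
  have "bilinear (\<lambda>(M :: complex^'m^'m) (N :: complex^'m^'m). M ** N)"
    by (auto simp: bilinear_def linear_iff matrix_scalar_ac
        scalar_matrix_assoc [symmetric] scaleR_sum_right vec_eq_iff matrix_matrix_mult_def sum.distrib distrib_left distrib_right)
  then have "bounded_bilinear (\<lambda>(M :: complex^'m^'m) (N :: complex^'m^'m). M ** N)"
    by (simp add: bilinear_conv_bounded_bilinear)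
  from bounded_bilinear.pos_bounded [OF this] show thesis
    using that by (metis mult.commute mult.left_commute)
qed

definition matrix_pow :: "complex^'m::finite^'m \<Rightarrow> nat \<Rightarrow> complex^'m^'m" where
  "matrix_pow Y k = ((\<lambda>N. Y ** N) ^^ k) (mat 1)"

lemma matrix_pow_scaleR: "matrix_pow (t *\<^sub>R Y) k = t ^ k *\<^sub>R matrix_pow Y k"
proof (induction k)
  case (Suc k)
  have "matrix_pow (t *\<^sub>R Y) (Suc k) = (t *\<^sub>R Y) ** matrix_pow (t *\<^sub>R Y) k"
    by (simp add: matrix_pow_def)
  also have "\<dots> = (t *\<^sub>R Y) ** (t ^ k *\<^sub>R matrix_pow Y k)"
    by (simp only: Suc)
  also have "\<dots> = t ^ Suc k *\<^sub>R (Y ** matrix_pow Y k)"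
    by (simp add: matrix_scalar_ac scalar_matrix_assoc [symmetric])
  also have "Y ** matrix_pow Y k = matrix_pow Y (Suc k)"
    by (simp add: matrix_pow_def)
  finally show ?case .
qed (simp add: matrix_pow_def)

lemma matrix_pow_norm_bound:
  fixes Y :: "complex^'m::finite^'m"
  obtains B where "B \<ge> 0" and "\<And>k. norm (matrix_pow Y k) \<le> norm (mat 1 :: complex^'m^'m) * B ^ k"
proof -
  obtain K where K: "K > 0" "\<And>(M :: complex^'m^'m) (N :: complex^'m^'m). norm (M ** N) \<le> K * norm M * norm N"
    by (rule norm_matrix_matrix_mult_bound, rule that)
  have "norm (matrix_pow Y k) \<le> norm (mat 1 :: complex^'m^'m) * (K * norm Y) ^ k" for k
  proof (induction k)
    case (Suc k)
    have "norm (matrix_pow Y (Suc k)) \<le> K * norm Y * norm (matrix_pow Y k)"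
      using K(2) [of Y "matrix_pow Y k"] by (simp add: matrix_pow_def)
    also have "\<dots> \<le> K * norm Y * (norm (mat 1 :: complex^'m^'m) * (K * norm Y) ^ k)"
      using K(1) by (intro mult_left_mono Suc) simp
    finally show ?case by (simp add: mult_ac)
  qed (simp add: matrix_pow_def)
  then show thesis
    using that [of "K * norm Y"] K(1) by simp
qed

lemma summable_matrix_pow:
  fixes Y :: "complex^'m::finite^'m"
  shows "summable (\<lambda>k. norm ((1 / fact k) *\<^sub>R matrix_pow Y k))"
proof -
  obtain B where B: "B \<ge> 0" "\<And>k. norm (matrix_pow Y k) \<le> norm (mat 1 :: complex^'m^'m) * B ^ k"
    using matrix_pow_norm_bound [of Y] by blast
  have "summable (\<lambda>k. norm (mat 1 :: complex^'m^'m) * (inverse (fact k) * B ^ k))"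
    by (intro summable_mult summable_exp)
  then show ?thesis
    by (rule summable_comparison_test' [of _ 0])
      (use B(2) in \<open>simp add: divide_inverse mult.left_commute\<close>)
qed

text \<open>Each entry becomes a scalar power series in t, which opens the way to termwise
  differentiation.\<close>

lemma mat_exp_nth:
  fixes Y :: "complex^'m::finite^'m"
  shows "mat_exp (t *\<^sub>R Y) $ i $ j = (\<Sum>k. matrix_pow Y k $ i $ j / fact k * complex_of_real t ^ k)"
proof -
  have "bounded_linear (\<lambda>M :: complex^'m^'m. M $ i $ j)"
    by (intro bounded_linear_compose [OF bounded_linear_vec_nth bounded_linear_vec_nth])
  then have "(\<Sum>k. ((1 / fact k) *\<^sub>R matrix_pow (t *\<^sub>R Y) k) $ i $ j) =
      (\<Sum>k. (1 / fact k) *\<^sub>R matrix_pow (t *\<^sub>R Y) k) $ i $ j"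
    by (rule bounded_linear.suminf [symmetric, where f = "\<lambda>M :: complex^'m^'m. M $ i $ j"])
      (rule summable_norm_cancel [OF summable_matrix_pow])
  moreover have "((1 / fact k) *\<^sub>R matrix_pow (t *\<^sub>R Y) k) $ i $ j =
      matrix_pow Y k $ i $ j / fact k * complex_of_real t ^ k" for k
    unfolding matrix_pow_scaleR vector_scaleR_component by (simp add: scaleR_conv_of_real)
  ultimately show ?thesis
    by (simp add: mat_exp_def matrix_pow_def)
qed

lemma mat_exp_0: "mat_exp (0 :: complex^'m::finite^'m) = mat 1"
proof -
  have "mat_exp (0 :: complex^'m^'m) $ i $ j = (mat 1 :: complex^'m^'m) $ i $ j" for i j
    using mat_exp_nth [of 0 0 i j] powser_zero [of "\<lambda>k. matrix_pow (0 :: complex^'m^'m) k $ i $ j / fact k"]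
    by (simp add: matrix_pow_def)
  then show ?thesis
    by (simp add: vec_eq_iff)
qed

text \<open>Derivatives are taken entry by entry and only at 0, so the scalar rules suffice.\<close>

definition entry_deriv :: "(real \<Rightarrow> complex^'n::finite^'m::finite) \<Rightarrow> complex^'n^'m \<Rightarrow> bool" where
  "entry_deriv M M' \<longleftrightarrow> (\<forall>i j. ((\<lambda>t. M t $ i $ j) has_vector_derivative M' $ i $ j) (at 0))"

lemma entry_deriv_mat_exp: "entry_deriv (\<lambda>t. mat_exp (t *\<^sub>R Y)) Y"
  unfolding entry_deriv_def
proof (intro allI)
  fix i j
  define c where "c k = matrix_pow Y k $ i $ j / fact k" for k
  have "summable (\<lambda>k. c k * y ^ k)" for y :: complex
  proof (rule summable_comparison_test' [of _ 0])
    \<comment> \<open>Termwise differentiation is used for complex arguments; the series at y is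
      dominated by that of the matrix exponential at the real parameter
      \<open>norm y\<close>.\<close>
    show "summable (\<lambda>k. norm ((1 / fact k) *\<^sub>R matrix_pow (norm y *\<^sub>R Y) k))"
      by (rule summable_matrix_pow)
    show "norm (c k * y ^ k) \<le> norm ((1 / fact k) *\<^sub>R matrix_pow (norm y *\<^sub>R Y) k)" for k
    proof -
      have "norm (matrix_pow Y k $ i $ j) \<le> norm (matrix_pow Y k)"
        by (meson Finite_Cartesian_Product.norm_nth_le order_trans)
      then show ?thesis
        by (simp add: c_def matrix_pow_scaleR norm_mult norm_divide norm_power divide_right_mono mult.commute
            mult_left_mono)
    qed
  qed
  then have "((\<lambda>x. \<Sum>k. c k * x ^ k) has_field_derivative (\<Sum>k. diffs c k * 0 ^ k)) (at 0)"
    by (rule termdiffs_strong_converges_everywhere)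
  then have "((\<lambda>x. \<Sum>k. c k * x ^ k) has_field_derivative Y $ i $ j) (at (complex_of_real 0))"
    by (simp add: powser_zero diffs_def c_def matrix_pow_def)
  then have "((\<lambda>t. \<Sum>k. c k * complex_of_real t ^ k) has_vector_derivative Y $ i $ j) (at 0)"
    by (rule has_vector_derivative_real_field)
  then show "((\<lambda>t. mat_exp (t *\<^sub>R Y) $ i $ j) has_vector_derivative Y $ i $ j) (at 0)"
    by (simp add: mat_exp_nth c_def)
qed

lemma entry_deriv_mult:
  assumes "entry_deriv M M'" "entry_deriv N N'"
  shows "entry_deriv (\<lambda>t. M t ** N t) (M 0 ** N' + M' ** N 0)"
  unfolding entry_deriv_def matrix_matrix_mult_def
  using assms by (auto simp: entry_deriv_def intro!: derivative_eq_intros simp: sum.distrib)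

lemma has_vector_derivative_bil:
  assumes "entry_deriv M M'"
  shows "((\<lambda>t. bil a (M t *v b)) has_vector_derivative bil a (M' *v b)) (at 0)"
  unfolding bil_def matrix_vector_mult_def
  using assms by (auto simp: entry_deriv_def intro!: derivative_eq_intros)

lemma entry_deriv_continuous:
  "entry_deriv M M' \<Longrightarrow> isCont (\<lambda>t. M t $ i $ j) 0"
  by (auto simp: entry_deriv_def intro: has_vector_derivative_continuous)

lemma isCont_det:
  fixes M :: "real \<Rightarrow> complex^'n::finite^'n"
  assumes "\<And>i j. isCont (\<lambda>t. M t $ i $ j) 0"
  shows "isCont (\<lambda>t. det (M t)) 0"
  unfolding det_def by (intro continuous_intros assms)

text \<open>Jacobi's formula at the identity. In the Leibniz sum only the identity permutation
  contributes: any other one moves two points, so after differentiating one factor an off-diagonal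
  zero is left.\<close>

lemma has_vector_derivative_det:
  fixes M :: "real \<Rightarrow> complex^'n::finite^'n"
  assumes M: "entry_deriv M M'" and "M 0 = mat 1"
  shows "((\<lambda>t. det (M t)) has_vector_derivative trace M') (at 0)"
proof -
  have deriv: "((\<lambda>t. \<Prod>i\<in>UNIV. M t $ i $ p i) has_vector_derivative
      (\<Sum>i\<in>UNIV. M' $ i $ p i * (\<Prod>j\<in>UNIV - {i}. M 0 $ j $ p j))) (at 0)" for p
  proof -
    have "((\<lambda>t. \<Prod>i\<in>UNIV. M t $ i $ p i) has_derivative
        (\<lambda>h. \<Sum>i\<in>UNIV. (h *\<^sub>R M' $ i $ p i) * (\<Prod>j\<in>UNIV - {i}. M 0 $ j $ p j))) (at 0)"
      using M by (intro has_derivative_prod) (simp add: entry_deriv_def has_vector_derivative_def)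
    then show ?thesis
      by (simp add: has_vector_derivative_def scaleR_sum_right)
  qed
  have "((\<lambda>t. det (M t)) has_vector_derivative
      (\<Sum>p | p permutes UNIV. of_int (sign p) * (\<Sum>i\<in>UNIV. M' $ i $ p i * (\<Prod>j\<in>UNIV - {i}. M 0 $ j $ p j)))) (at 0)"
    unfolding det_def by (intro has_vector_derivative_sum has_vector_derivative_mult_right deriv)
  also have "(\<Sum>p | p permutes UNIV. of_int (sign p) * (\<Sum>i\<in>UNIV. M' $ i $ p i * (\<Prod>j\<in>UNIV - {i}. M 0 $ j $ p j))) =
      (\<Sum>p\<in>{id}. of_int (sign p) * (\<Sum>i\<in>UNIV. M' $ i $ p i * (\<Prod>j\<in>UNIV - {i}. M 0 $ j $ p j)))"
  proof (rule sum.mono_neutral_right)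
    show "\<forall>p\<in>{p. p permutes UNIV} - {id}.
        of_int (sign p) * (\<Sum>i\<in>UNIV. M' $ i $ p i * (\<Prod>j\<in>UNIV - {i}. M 0 $ j $ p j)) = 0"
    proof
      fix p :: "'n \<Rightarrow> 'n"
      assume p: "p \<in> {p. p permutes UNIV} - {id}"
      have "(\<Prod>j\<in>UNIV - {i}. M 0 $ j $ p j) = 0" for i
      proof -
        obtain j where j: "p j \<noteq> j"
          using p by (auto simp: fun_eq_iff)
        \<comment> \<open>Injectivity makes \<open>p j\<close> a second moved point, and one of j
          and \<open>p j\<close> differs from the omitted index i.\<close>
        moreover have "p (p j) \<noteq> p j"
          using p j by (auto dest: permutes_inj simp: inj_eq)
        ultimately obtain k where "k \<noteq> i" "p k \<noteq> k"
          by metis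
        then show ?thesis
          by (intro prod_zero) (auto simp: assms(2) mat_def intro!: bexI [of _ k])
      qed
      then show "of_int (sign p) * (\<Sum>i\<in>UNIV. M' $ i $ p i * (\<Prod>j\<in>UNIV - {i}. M 0 $ j $ p j)) = 0"
        by (simp only: mult_zero_right sum.neutral_const)
    qed
  qed (simp_all add: permutes_id finite_permutations)
  also have "\<dots> = trace M'"
    by (simp add: assms(2) trace_def mat_def sign_id)
  finally show ?thesis .
qed

lemma matrix_inv_mult:
  fixes P :: "complex^'n::finite^'n"
  assumes "det P \<noteq> 0"
  shows "P ** matrix_inv P = mat 1" "matrix_inv P ** P = mat 1"
proof -
  have "\<exists>R. P ** R = mat 1 \<and> R ** P = mat 1"
    using assms invertible_det_nz [of P] by (simp add: invertible_def)
  from someI_ex [OF this] show "P ** matrix_inv P = mat 1" "matrix_inv P ** P = mat 1"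
    by (simp_all add: matrix_inv_def)
qed

lemma matrix_inv_nth:
  fixes P :: "complex^'n::finite^'n"
  assumes "det P \<noteq> 0"
  shows "matrix_inv P $ k $ j = det (\<chi> i l. if l = k then axis j 1 $ i else P $ i $ l) / det P"
proof -
  have "P *v (\<chi> i. matrix_inv P $ i $ j) = (\<chi> i. (P ** matrix_inv P) $ i $ j)"
    by (simp add: matrix_vector_mult_def matrix_matrix_mult_def)
  also have "\<dots> = axis j 1"
    by (simp add: matrix_inv_mult [OF assms] vec_eq_iff mat_def axis_def)
  finally have "(\<chi> i. matrix_inv P $ i $ j) = (\<chi> k. det (\<chi> i l. if l = k then axis j 1 $ i else P $ i $ l) / det P)"
    using cramer [OF assms] by blast
  then show ?thesis
    by (simp add: vec_eq_iff)
qed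

lemma matrix_inv_mat_1: "matrix_inv (mat 1) = (mat 1 :: complex^'n::finite^'n)"
  using matrix_inv_mult(1) [of "mat 1 :: complex^'n^'n"] by simp

text \<open>Because f vanishes at 0, continuity of g is enough for the product rule. So an inverse
  matrix can be differentiated without knowing in advance that it is differentiable.\<close>

lemma has_vector_derivative_mult_zero:
  fixes f g :: "real \<Rightarrow> complex"
  assumes "(f has_vector_derivative f') (at 0)" "f 0 = 0" "isCont g 0"
  shows "((\<lambda>t. f t * g t) has_vector_derivative f' * g 0) (at 0)"
proof -
  have f: "(\<lambda>h. norm (f h - h *\<^sub>R f') / norm h) \<midarrow>0\<rightarrow> 0"
    using assms(1,2) by (simp add: has_vector_derivative_def has_derivative_at)
  have g: "g \<midarrow>0\<rightarrow> g 0"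
    using assms(3) by (simp add: isCont_def)
  have lim: "(\<lambda>h. norm (f h - h *\<^sub>R f') / norm h * norm (g h) + norm f' * norm (g h - g 0)) \<midarrow>0\<rightarrow> 0"
    using tendsto_add [OF tendsto_mult [OF f tendsto_norm [OF g]]
        tendsto_mult [OF tendsto_const [of "norm f'"] tendsto_norm [OF tendsto_diff [OF g tendsto_const [of "g 0"]]]]]
    by simp
  have "(\<lambda>h. norm (f h * g h - h *\<^sub>R (f' * g 0)) / norm h) \<midarrow>0\<rightarrow> 0"
  proof (rule Lim_null_comparison [OF _ lim], rule eventuallyI)
    fix h :: real
    have "f h * g h - h *\<^sub>R (f' * g 0) = (f h - h *\<^sub>R f') * g h + h *\<^sub>R (f' * (g h - g 0))"
      by (simp add: algebra_simps)
    then have "norm (f h * g h - h *\<^sub>R (f' * g 0)) \<le>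
        norm (f h - h *\<^sub>R f') * norm (g h) + norm h * (norm f' * norm (g h - g 0))"
      using norm_triangle_ineq [of "(f h - h *\<^sub>R f') * g h" "h *\<^sub>R (f' * (g h - g 0))"]
      by (simp only: norm_mult norm_scaleR real_norm_def)
    then have "norm (f h * g h - h *\<^sub>R (f' * g 0)) / norm h \<le>
        (norm (f h - h *\<^sub>R f') * norm (g h) + norm h * (norm f' * norm (g h - g 0))) / norm h"
      by (rule divide_right_mono) simp
    also have "\<dots> \<le> norm (f h - h *\<^sub>R f') / norm h * norm (g h) + norm f' * norm (g h - g 0)"
      by (cases "h = 0") (simp_all add: add_divide_distrib)
    finally show "norm (norm (f h * g h - h *\<^sub>R (f' * g 0)) / norm h) \<le>
        norm (f h - h *\<^sub>R f') / norm h * norm (g h) + norm f' * norm (g h - g 0)"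
      by simp
  qed
  moreover have "bounded_linear (\<lambda>h. h *\<^sub>R (f' * g 0))"
    by (rule bounded_linear_scaleR_left)
  ultimately show ?thesis
    using assms(2) by (simp add: has_vector_derivative_def has_derivative_at)
qed

text \<open>Cramer's rule gives the continuity of \<open>R = matrix_inv (P t)\<close>; the derivative is then read off
  from \<open>R = mat 1 - (P t - mat 1) ** R\<close>, whose product has a factor vanishing at \<open>0\<close>.\<close>

lemma entry_deriv_matrix_inv:
  fixes P :: "real \<Rightarrow> complex^'n::finite^'n"
  assumes P: "entry_deriv P P'" and P0: "P 0 = mat 1"
  shows "\<forall>\<^sub>F t in nhds 0. det (P t) \<noteq> 0" and "entry_deriv (\<lambda>t. matrix_inv (P t)) (- P')"
proof -
  have "isCont (\<lambda>t. det (P t)) 0"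
    by (intro isCont_det entry_deriv_continuous [OF P])
  moreover have "det (P 0) \<noteq> 0"
    by (simp add: P0)
  ultimately show ev: "\<forall>\<^sub>F t in nhds 0. det (P t) \<noteq> 0"
    by (simp add: isCont_def tendsto_imp_eventually_ne eventually_nhds_conv_at)
  have cont: "isCont (\<lambda>t. matrix_inv (P t) $ k $ j) 0" for k j
  proof -
    have "isCont (\<lambda>t. if l = k then axis j 1 $ i else P t $ i $ l) 0" for i l
      by (cases "l = k") (simp_all add: entry_deriv_continuous [OF P])
    then have "isCont (\<lambda>t. det (\<chi> i l. if l = k then axis j 1 $ i else P t $ i $ l) / det (P t)) 0"
      using \<open>det (P 0) \<noteq> 0\<close>
      by (intro continuous_divide isCont_det entry_deriv_continuous [OF P])
        simp_all
    moreover have "\<forall>\<^sub>F t in nhds 0. matrix_inv (P t) $ k $ j =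
        det (\<chi> i l. if l = k then axis j 1 $ i else P t $ i $ l) / det (P t)"
      using ev by eventually_elim (rule matrix_inv_nth)
    ultimately show ?thesis
      by (subst isCont_cong)
  qed
  have eq: "\<forall>\<^sub>F t in nhds 0. mat 1 $ i $ j - (\<Sum>k\<in>UNIV. (P t $ i $ k - mat 1 $ i $ k) * matrix_inv (P t) $ k $ j) =
      matrix_inv (P t) $ i $ j" for i j
    using ev
  proof eventually_elim
    case (elim t)
    have "(P t ** matrix_inv (P t)) $ i $ j = mat 1 $ i $ j"
      by (simp add: matrix_inv_mult [OF elim])
    moreover have "(\<Sum>k\<in>UNIV. mat 1 $ i $ k * matrix_inv (P t) $ k $ j) = matrix_inv (P t) $ i $ j"
      by (simp add: mat_def if_distrib [of "\<lambda>c. c * _"] cong: if_cong)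
    ultimately show ?case
      by (simp add: matrix_matrix_mult_def left_diff_distrib sum_subtractf)
  qed
  show "entry_deriv (\<lambda>t. matrix_inv (P t)) (- P')"
    unfolding entry_deriv_def
  proof (intro allI)
    fix i j
    have deriv: "((\<lambda>t. P t $ i $ k - mat 1 $ i $ k) has_vector_derivative P' $ i $ k - 0) (at 0)" for k
      using P by (intro has_vector_derivative_diff has_vector_derivative_const) (simp add: entry_deriv_def)
    have "((\<lambda>t. mat 1 $ i $ j - (\<Sum>k\<in>UNIV. (P t $ i $ k - mat 1 $ i $ k) * matrix_inv (P t) $ k $ j))
        has_vector_derivative 0 - (\<Sum>k\<in>UNIV. (P' $ i $ k - 0) * matrix_inv (P 0) $ k $ j)) (at 0)"
      by (rule has_vector_derivative_diff has_vector_derivative_const has_vector_derivative_sum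
          has_vector_derivative_mult_zero [OF deriv _ cont])+ (simp add: P0)
    moreover have "0 - (\<Sum>k\<in>UNIV. (P' $ i $ k - 0) * matrix_inv (P 0) $ k $ j) = (- P') $ i $ j"
      by (simp add: P0 matrix_inv_mat_1) (simp add: mat_def if_distrib cong: if_cong)
    moreover have "((\<lambda>t. mat 1 $ i $ j - (\<Sum>k\<in>UNIV. (P t $ i $ k - mat 1 $ i $ k) * matrix_inv (P t) $ k $ j))
        has_vector_derivative (- P') $ i $ j) (at 0) \<longleftrightarrow>
      ((\<lambda>t. matrix_inv (P t) $ i $ j) has_vector_derivative (- P') $ i $ j) (at 0)"
      using eq [of i j] by (intro has_vector_derivative_cong_ev) (auto elim: eventually_mono dest: eventually_nhds_x_imp_x)
    ultimately show "((\<lambda>t. matrix_inv (P t) $ i $ j) has_vector_derivative (- P') $ i $ j) (at 0)"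
      by simp
  qed
qed

section \<open>The differential of the metaplectic representation\<close>

lemma bounded_linear_bil: "bounded_linear (bil u)"
proof -
  have "linear (bil u)"
    by (simp add: linear_iff bil_def sum.distrib distrib_left scaleR_sum_right)
  then show ?thesis
    by (simp add: linear_conv_bounded_linear)
qed

text \<open>Both \<open>metaplectic\<close> and \<open>d_metaplectic\<close> are restricted to the
  Fock space, so membership is what allows them to be evaluated on coherent states.\<close>

lemma coherent_in_fock_space: "coherent w \<in> (fock_space :: (complex^'n::finite \<Rightarrow> complex) set)"
proof -
  define u where "u = cnj_vec w"
  define K where "K = (\<Sum>j\<in>UNIV. cmod (u $ j))"
  have coherent: "coherent w = (\<lambda>z. exp (bil u z / 2))"
    by (simp add: coherent_def u_def)
  have deriv: "((\<lambda>z. bil u z / 2) has_derivative (\<lambda>h. bil u h / 2)) (at z)" for z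
    by (intro bounded_linear_imp_has_derivative bounded_linear_compose [OF bounded_linear_divide bounded_linear_bil])
  have "entire_Cn (coherent w)"
    unfolding entire_Cn_def coherent
    by (intro allI exI conjI,
        rule has_derivative_compose [OF deriv DERIV_exp [unfolded has_field_derivative_def]])
      (simp add: bil_simps)
  moreover have "integrable mu (\<lambda>z. (cmod (coherent w z))\<^sup>2 * exp (- (norm z)\<^sup>2 / 2))"
  proof -
    have "integrable lborel (\<lambda>z. (cmod (coherent w z))\<^sup>2 * exp (- (norm z)\<^sup>2 / 2))"
    proof (rule Bochner_Integration.integrable_bound)
      show "integrable lborel (\<lambda>z :: complex^'n. exp (K\<^sup>2) * exp (- (1 / 4) * (norm z)\<^sup>2))"
        by (intro integrable_mult_right integrable_exp_norm) simp
      have "continuous_on UNIV (\<lambda>z. (cmod (coherent w z))\<^sup>2 * exp (- (norm z)\<^sup>2 / 2))"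
        unfolding coherent by (intro continuous_intros) auto
      then show "(\<lambda>z. (cmod (coherent w z))\<^sup>2 * exp (- (norm z)\<^sup>2 / 2)) \<in> borel_measurable lborel"
        by (simp add: borel_measurable_continuous_onI)
      have "(cmod (coherent w z))\<^sup>2 * exp (- (norm z)\<^sup>2 / 2) \<le> exp (K\<^sup>2) * exp (- (1 / 4) * (norm z)\<^sup>2)" for z
      proof -
        have "Re (bil u z) \<le> K * norm z"
          using order_trans [OF complex_Re_le_cmod cmod_bil_le] by (simp add: K_def)
        also have "\<dots> \<le> K\<^sup>2 + (norm z)\<^sup>2 / 4"
          \<comment> \<open>The linear exponent costs |z|^2 / 4, half of the decay of the
            weight.\<close>
          using zero_le_power2 [of "2 * K - norm z"] by (simp add: power2_eq_square algebra_simps)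
        finally have "Re (bil u z) + - (norm z)\<^sup>2 / 2 \<le> K\<^sup>2 + - (1 / 4) * (norm z)\<^sup>2"
          by simp
        moreover have "(cmod (coherent w z))\<^sup>2 = exp (Re (bil u z))"
          by (simp add: coherent power2_eq_square flip: exp_add)
        ultimately show ?thesis
          by (simp only: exp_add [symmetric] exp_le_cancel_iff)
      qed
      then show "AE z in lborel. norm ((cmod (coherent w z))\<^sup>2 * exp (- (norm z)\<^sup>2 / 2)) \<le>
          norm (exp (K\<^sup>2) * exp (- (1 / 4) * (norm z)\<^sup>2))"
        by simp
    qed
    then show ?thesis
      unfolding mu_def by (subst integrable_density) (simp_all add: borel_measurable_integrable)
  qed
  ultimately show ?thesis
    by (simp add: fock_space_def)
qed

text \<open>A crude bound, but continuous in the entries, hence convenient for matrices that depend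
  on t.\<close>

lemma cmod_bil_matrix_le:
  "cmod (bil v (M *v v)) \<le> (\<Sum>i\<in>UNIV. \<Sum>j\<in>UNIV. cmod (M $ i $ j)) * (norm v)\<^sup>2"
proof -
  have "bil v (M *v v) = (\<Sum>i\<in>UNIV. \<Sum>j\<in>UNIV. v $ i * (M $ i $ j * v $ j))"
    by (simp add: bil_def matrix_vector_mult_def sum_distrib_left)
  also have "cmod \<dots> \<le> (\<Sum>i\<in>UNIV. \<Sum>j\<in>UNIV. cmod (v $ i * (M $ i $ j * v $ j)))"
    by (intro sum_norm_le norm_sum)
  also have "\<dots> \<le> (\<Sum>i\<in>UNIV. \<Sum>j\<in>UNIV. cmod (M $ i $ j) * (norm v)\<^sup>2)"
  proof (intro sum_mono)
    fix i j
    have "cmod (v $ i) * cmod (v $ j) \<le> norm v * norm v"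
      by (intro mult_mono Finite_Cartesian_Product.norm_nth_le) simp_all
    then have "cmod (M $ i $ j) * (cmod (v $ i) * cmod (v $ j)) \<le> cmod (M $ i $ j) * (norm v * norm v)"
      by (rule mult_left_mono) simp
    then show "cmod (v $ i * (M $ i $ j * v $ j)) \<le> cmod (M $ i $ j) * (norm v)\<^sup>2"
      by (simp add: norm_mult power2_eq_square mult_ac)
  qed
  finally show ?thesis
    by (simp add: sum_distrib_right)
qed

lemma scaleR_matrix_vector_mult: "(c *\<^sub>R M) *v v = c *\<^sub>R (M *v (v :: complex^'n::finite))"
  by (simp add: vec_eq_iff matrix_vector_mult_def scaleR_sum_right)

lemma bil_scaleR: "bil (c *\<^sub>R x) y = complex_of_real c * bil x y" "bil x (c *\<^sub>R y) = complex_of_real c * bil x y"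
  unfolding bil_def vector_scaleR_component
  by (simp_all only: sum_distrib_left scaleR_conv_of_real mult_ac)

text \<open>In its second variable the kernel is a constant times an exponential of a linear and a
  quadratic form in the conjugate, with matrix - M / 4. The bound 1/2 on the entries of M is thus
  the 1/8 that the reproducing property requires.\<close>

lemma metaplectic_coherent:
  fixes k :: "complex^('n::finite + 'n)^('n + 'n)"
  defines "M \<equiv> matrix_inv (upper_left k) ** upper_right k"
  assumes "(\<Sum>i\<in>UNIV. \<Sum>j\<in>UNIV. cmod (M $ i $ j)) \<le> 1 / 2"
  shows "metaplectic k (coherent w) z = metaplectic_kernel k z w"
proof -
  let ?P = "upper_left k" and ?Q = "upper_right k"
  let ?R = "matrix_inv ?P"
  define N where "N = (- 1 / 4) *\<^sub>R M"
  define l where "l = (1 / 2) *\<^sub>R (?R *v z)"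
  define c where "c = inverse (csqrt (det ?P)) * exp (bil z ((map_matrix cnj ?Q ** ?R) *v z) / 4)"
  have bil_N: "bil v (N *v v) = - bil v (M *v v) / 4" for v
    unfolding N_def scaleR_matrix_vector_mult bil_scaleR by simp
  have kernel: "metaplectic_kernel k z v = c * exp (bil l (cnj_vec v) + bil (cnj_vec v) (N *v cnj_vec v))" for v
    by (simp add: metaplectic_kernel_def Let_def c_def l_def bil_N M_def [symmetric] bil_scaleR
        add_divide_distrib diff_divide_distrib add_diff_eq mult.assoc flip: exp_add)
  have N: "cmod (bil v (N *v v)) \<le> (norm v)\<^sup>2 / 8" for v
  proof -
    have "cmod (bil v (N *v v)) = cmod (bil v (M *v v)) / 4"
      by (simp add: bil_N norm_divide)
    also have "\<dots> \<le> 1 / 2 * (norm v)\<^sup>2 / 4"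
      using order_trans [OF cmod_bil_matrix_le mult_right_mono [OF assms(2)]]
      by (intro divide_right_mono) simp_all
    finally show ?thesis by simp
  qed
  have "metaplectic k (coherent w) z = (\<integral>v. c * (exp (bil l (cnj_vec v) + bil (cnj_vec v) (N *v cnj_vec v)) *
      exp (bil (cnj_vec w) v / 2) * exp (- complex_of_real ((norm v)\<^sup>2) / 2)) \<partial>mu)"
    unfolding metaplectic_def restrict_apply' [OF coherent_in_fock_space]
    by (simp only: kernel coherent_def mult.assoc)
  also have "\<dots> = c * exp (bil l (cnj_vec w) + bil (cnj_vec w) (N *v cnj_vec w))"
    by (simp only: integral_mult_right_zero reproducing_exp_quadratic [OF N])
  finally show ?thesis
    by (simp only: kernel)
qed

lemma entry_deriv_map_cnj: "entry_deriv M M' \<Longrightarrow> entry_deriv (\<lambda>t. map_matrix cnj (M t)) (map_matrix cnj M')"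
  by (auto simp: entry_deriv_def intro!: bounded_linear.has_vector_derivative [OF bounded_linear_cnj])

text \<open>At t = 0 the blocks are the identity and 0, so products with Q differentiate to Q', the
  inverse of P to - P', and the determinant to trace P'.\<close>

lemma has_vector_derivative_kernel:
  fixes P Q :: "real \<Rightarrow> complex^'n::finite^'n" and z v :: "complex^'n"
  assumes P: "entry_deriv P P'" "P 0 = mat 1" and Q: "entry_deriv Q Q'" "Q 0 = 0"
  shows "((\<lambda>t. inverse (csqrt (det (P t))) *
      exp ((bil z ((map_matrix cnj (Q t) ** matrix_inv (P t)) *v z) + 2 * bil (matrix_inv (P t) *v z) v
        - bil v ((matrix_inv (P t) ** Q t) *v v)) / 4)) has_vector_derivative
    (- trace P' / 2 + (bil z (map_matrix cnj Q' *v z) - 2 * bil v (P' *v z) - bil v (Q' *v v)) / 4) *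
      exp (bil z v / 2)) (at 0)"
proof -
  define R where "R t = matrix_inv (P t)" for t
  have R: "entry_deriv R (- P')" "R 0 = mat 1"
    using entry_deriv_matrix_inv(2) [OF P] by (simp_all add: R_def [abs_def] P(2) matrix_inv_mat_1)
  have cnj0: "map_matrix cnj (0 :: complex^'n^'n) = 0"
    by (simp add: vec_eq_iff map_matrix_def)
  define E where "E t = (bil z ((map_matrix cnj (Q t) ** R t) *v z) + 2 * bil v (R t *v z)
      - bil v ((R t ** Q t) *v v)) / 4" for t
  have E0: "E 0 = bil z v / 2"
    by (simp add: E_def cnj0 Q(2) R(2) bil_simps bil_commute [of v])
  have "entry_deriv (\<lambda>t. map_matrix cnj (Q t) ** R t) (map_matrix cnj Q')"
    using entry_deriv_mult [OF entry_deriv_map_cnj [OF Q(1)] R(1)] by (simp add: cnj0 Q(2) R(2))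
  moreover have "entry_deriv (\<lambda>t. R t ** Q t) Q'"
    using entry_deriv_mult [OF R(1) Q(1)] by (simp add: Q(2) R(2))
  ultimately have "(E has_vector_derivative
      (bil z (map_matrix cnj Q' *v z) + 2 * bil v (- P' *v z) - bil v (Q' *v v)) / 4) (at 0)"
    unfolding E_def [abs_def] using R(1)
    by (intro has_vector_derivative_divide has_vector_derivative_diff has_vector_derivative_add
        has_vector_derivative_mult_right has_vector_derivative_bil)
  then have E: "((\<lambda>t. exp (E t)) has_vector_derivative
      (bil z (map_matrix cnj Q' *v z) + 2 * bil v (- P' *v z) - bil v (Q' *v v)) / 4 * exp (E 0)) (at 0)"
    using field_vector_diff_chain_at [OF _ DERIV_exp] by (simp only: o_def)
  \<comment> \<open>The determinant is 1 here, off the branch cut of the principal root.\<close>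
  have "((\<lambda>d. inverse (csqrt d)) has_field_derivative - 1 / 2) (at (det (P 0)))"
    by (auto simp: P(2) intro!: derivative_eq_intros)
  then have D: "((\<lambda>t. inverse (csqrt (det (P t)))) has_vector_derivative trace P' * (- 1 / 2)) (at 0)"
    using field_vector_diff_chain_at [OF has_vector_derivative_det [OF P]] by (simp only: o_def)
  have "((\<lambda>t. inverse (csqrt (det (P t))) * exp (E t)) has_vector_derivative
    (- trace P' / 2 + (bil z (map_matrix cnj Q' *v z) - 2 * bil v (P' *v z) - bil v (Q' *v v)) / 4) *
      exp (bil z v / 2)) (at 0)"
  proof -
    have "- P' *v z = - (P' *v z)"
      by (simp add: vec_eq_iff matrix_vector_mult_def sum_negf)
    then have "inverse (csqrt (det (P 0))) *
        ((bil z (map_matrix cnj Q' *v z) + 2 * bil v (- P' *v z) - bil v (Q' *v v)) / 4 * exp (E 0)) +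
        trace P' * (- 1 / 2) * exp (E 0) =
      (- trace P' / 2 + (bil z (map_matrix cnj Q' *v z) - 2 * bil v (P' *v z) - bil v (Q' *v v)) / 4) *
        exp (bil z v / 2)"
      by (simp add: P(2) E0 bil_simps field_simps)
    then show ?thesis
      using has_vector_derivative_mult [OF D E] by simp
  qed
  then show ?thesis
    by (simp add: E_def R_def bil_commute [of v "matrix_inv _ *v z"])
qed

text \<open>P and Q are the upper blocks of the Lie algebra element itself, and v takes the
  conjugate of the second kernel variable, so that the expression is polynomial in z and v up to the
  exponential.\<close>

definition d_metaplectic_kernel ::
  "complex^'n::finite^'n \<Rightarrow> complex^'n^'n \<Rightarrow> complex^'n \<Rightarrow> complex^'n \<Rightarrow> complex" where
  "d_metaplectic_kernel P Q z v =
    (- trace P / 2 + (bil z (map_matrix cnj Q *v z) - 2 * bil v (P *v z) - bil v (Q *v v)) / 4) * exp (bil z v / 2)"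

lemma d_metaplectic_coherent:
  fixes Y :: "complex^('n::finite + 'n)^('n + 'n)"
  shows "d_metaplectic Y (coherent w) z = d_metaplectic_kernel (upper_left Y) (upper_right Y) z (cnj_vec w)"
proof -
  define P Q where "P t = upper_left (mat_exp (t *\<^sub>R Y))" and "Q t = upper_right (mat_exp (t *\<^sub>R Y))" for t
  have P: "entry_deriv P (upper_left Y)" "P 0 = mat 1" and Q: "entry_deriv Q (upper_right Y)" "Q 0 = 0"
    using entry_deriv_mat_exp [of Y]
    by (simp_all add: P_def Q_def entry_deriv_def upper_left_def upper_right_def mat_exp_0 vec_eq_iff mat_def)
  have "entry_deriv (\<lambda>t. matrix_inv (P t) ** Q t) (upper_right Y)"
    using entry_deriv_mult [OF entry_deriv_matrix_inv(2) [OF P] Q(1)] by (simp add: P(2) Q(2) matrix_inv_mat_1)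
  \<comment> \<open>At t = 0 this sum is 0, so by continuity it stays below 1/2 nearby, where the
    operator applied to a coherent state equals its kernel.\<close>
  then have "isCont (\<lambda>t. \<Sum>i\<in>UNIV. \<Sum>j\<in>UNIV. cmod ((matrix_inv (P t) ** Q t) $ i $ j)) 0"
    by (intro continuous_intros entry_deriv_continuous)
  then have "((\<lambda>t. \<Sum>i\<in>UNIV. \<Sum>j\<in>UNIV. cmod ((matrix_inv (P t) ** Q t) $ i $ j)) \<longlongrightarrow> 0) (nhds 0)"
    by (simp add: isCont_def tendsto_nhds_iff Q(2))
  then have "\<forall>\<^sub>F t in nhds 0. (\<Sum>i\<in>UNIV. \<Sum>j\<in>UNIV. cmod ((matrix_inv (P t) ** Q t) $ i $ j)) < 1 / 2"
    by (rule order_tendstoD) simp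
  then have ev: "\<forall>\<^sub>F t in nhds 0. metaplectic_kernel (mat_exp (t *\<^sub>R Y)) z w = metaplectic (mat_exp (t *\<^sub>R Y)) (coherent w) z"
    by eventually_elim (rule metaplectic_coherent [symmetric], simp add: P_def Q_def)
  have "((\<lambda>t. metaplectic_kernel (mat_exp (t *\<^sub>R Y)) z w) has_vector_derivative
      d_metaplectic_kernel (upper_left Y) (upper_right Y) z (cnj_vec w)) (at 0)"
    using has_vector_derivative_kernel [OF P Q, of z "cnj_vec w"]
    by (simp add: metaplectic_kernel_def Let_def P_def Q_def d_metaplectic_kernel_def)
  moreover have "((\<lambda>t. metaplectic_kernel (mat_exp (t *\<^sub>R Y)) z w) has_vector_derivative
      d_metaplectic_kernel (upper_left Y) (upper_right Y) z (cnj_vec w)) (at 0) \<longleftrightarrow>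
    ((\<lambda>t. metaplectic (mat_exp (t *\<^sub>R Y)) (coherent w) z) has_vector_derivative
      d_metaplectic_kernel (upper_left Y) (upper_right Y) z (cnj_vec w)) (at 0)"
    using ev by (intro has_vector_derivative_cong_ev) (auto elim: eventually_mono dest: eventually_nhds_x_imp_x)
  ultimately show ?thesis
    by (simp add: d_metaplectic_def coherent_in_fock_space vector_derivative_at)
qed

text \<open>Unfolding yields \<open>bargmann\<close> after \<open>bargmann_inv\<close> twice: once
  on \<open>coherent w\<close>, once on its image under \<open>d_metaplectic Y\<close>. Both lie in
  the range of the transform, so both compositions disappear.\<close>

lemma op_kernel_d_metaplectic':
  fixes X :: "real^('n::finite + 'n)^('n + 'n)"
  defines "Y \<equiv> U_mat ** map_matrix complex_of_real X ** matrix_inv U_mat"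
  shows "op_kernel (bargmann \<circ> d_metaplectic' X \<circ> bargmann_inv) z w =
    d_metaplectic_kernel (upper_left Y) (upper_right Y) z (cnj_vec w)"
proof -
  let ?P = "upper_left Y" and ?Q = "upper_right Y" and ?v = "cnj_vec w"
  have inv: "bargmann (bargmann_inv F) = F" if "F \<in> bargmann ` L2_functions" for F :: "complex^'n \<Rightarrow> complex"
    using that by (simp add: bargmann_inv_def f_inv_into_f)
  have "coherent w \<in> bargmann ` L2_functions"
    unfolding coherent_def by (rule exp_bil_in_bargmann_range(1))
  moreover have "d_metaplectic Y (coherent w) \<in> bargmann ` L2_functions"
  proof -
    \<comment> \<open>The kernel sorted by degree in z: constant, linear, quadratic, with the common
      factor 1/4 taken out.\<close>
    have "(\<lambda>z. 1 / 4 * (((- 2 * trace ?P - bil ?v (?Q *v ?v)) + bil (- 2 *s (transpose ?P *v ?v)) z +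
        bil z (map_matrix cnj ?Q *v z)) * exp (bil ?v z / 2))) \<in> bargmann ` L2_functions"
      by (intro bargmann_range_mult_left quadratic_exp_bil_in_bargmann_range)
    also have "(\<lambda>z. 1 / 4 * (((- 2 * trace ?P - bil ?v (?Q *v ?v)) + bil (- 2 *s (transpose ?P *v ?v)) z +
        bil z (map_matrix cnj ?Q *v z)) * exp (bil ?v z / 2))) = d_metaplectic Y (coherent w)"
      by (simp add: fun_eq_iff d_metaplectic_coherent d_metaplectic_kernel_def bil_simps
          bil_transpose [symmetric] bil_commute [of ?v] field_simps del: transpose_matrix_vector)
    finally show ?thesis .
  qed
  ultimately show ?thesis
    by (simp add: op_kernel_def d_metaplectic'_def inv Y_def [symmetric] d_metaplectic_coherent)
qed

section \<open>The Weyl symbol\<close>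

lemma gaussian_0_complex: "gaussian (\<lambda>_. 0) w = exp (- bil w (cnj_vec w))"
  by (simp add: gaussian_def power2_norm_eq_inner [symmetric] of_real_norm_squared del: of_real_power)

lemma bil_matrix_vector_mult: "bil u (M *v v) = (\<Sum>i\<in>UNIV. \<Sum>j\<in>UNIV. M $ i $ j * (u $ i * v $ j))"
  by (simp add: bil_def matrix_vector_mult_def sum_distrib_left mult.left_commute)

lemma has_bochner_integral_mu_forms:
  fixes a :: "complex^'n::finite" and M :: "complex^'n^'n"
  shows "has_bochner_integral mu (\<lambda>w. bil a w * gaussian (\<lambda>_. 0) w) 0"
    and "has_bochner_integral mu (\<lambda>w. bil a (cnj_vec w) * gaussian (\<lambda>_. 0) w) 0"
    and "has_bochner_integral mu (\<lambda>w. bil w (M *v w) * gaussian (\<lambda>_. 0) w) 0"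
    and "has_bochner_integral mu (\<lambda>w. bil (cnj_vec w) (M *v cnj_vec w) * gaussian (\<lambda>_. 0) w) 0"
    and "has_bochner_integral mu (\<lambda>w. bil (cnj_vec w) (M *v w) * gaussian (\<lambda>_. 0) w) (trace M / 2 ^ CARD('n))"
proof -
  note moments = has_bochner_integral_mu_moments [where 'n = 'n]
  have cnj_nth: "cnj_vec w $ i = cnj (w $ i)" for w :: "complex^'n" and i
    by (simp add: cnj_vec_def)
  have "has_bochner_integral mu (\<lambda>w. \<Sum>j\<in>UNIV. a $ j * (w $ j * gaussian (\<lambda>_. 0) w)) (\<Sum>j\<in>UNIV. a $ j * 0)"
    by (intro has_bochner_integral_sum has_bochner_integral_mult_right moments(1))
  then show "has_bochner_integral mu (\<lambda>w. bil a w * gaussian (\<lambda>_. 0) w) 0"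
    by (simp add: bil_def sum_distrib_right mult.assoc)
  have "has_bochner_integral mu (\<lambda>w. \<Sum>j\<in>UNIV. a $ j * (cnj (w $ j) * gaussian (\<lambda>_. 0) w)) (\<Sum>j\<in>UNIV. a $ j * 0)"
    by (intro has_bochner_integral_sum has_bochner_integral_mult_right moments(2))
  then show "has_bochner_integral mu (\<lambda>w. bil a (cnj_vec w) * gaussian (\<lambda>_. 0) w) 0"
    by (simp add: bil_def cnj_nth sum_distrib_right mult.assoc)
  have "has_bochner_integral mu (\<lambda>w. \<Sum>i\<in>UNIV. \<Sum>j\<in>UNIV. M $ i $ j * (w $ i * w $ j * gaussian (\<lambda>_. 0) w))
      (\<Sum>i\<in>UNIV. \<Sum>j\<in>UNIV. M $ i $ j * 0)"
    by (intro has_bochner_integral_sum has_bochner_integral_mult_right moments(3))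
  then show "has_bochner_integral mu (\<lambda>w. bil w (M *v w) * gaussian (\<lambda>_. 0) w) 0"
    by (simp add: bil_matrix_vector_mult sum_distrib_right mult.assoc)
  have "has_bochner_integral mu
      (\<lambda>w. \<Sum>i\<in>UNIV. \<Sum>j\<in>UNIV. M $ i $ j * (cnj (w $ i) * cnj (w $ j) * gaussian (\<lambda>_. 0) w))
      (\<Sum>i\<in>UNIV. \<Sum>j\<in>UNIV. M $ i $ j * 0)"
    by (intro has_bochner_integral_sum has_bochner_integral_mult_right moments(4))
  then show "has_bochner_integral mu (\<lambda>w. bil (cnj_vec w) (M *v cnj_vec w) * gaussian (\<lambda>_. 0) w) 0"
    by (simp add: bil_matrix_vector_mult cnj_nth sum_distrib_right mult.assoc)
  have "has_bochner_integral mu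
      (\<lambda>w. \<Sum>i\<in>UNIV. \<Sum>j\<in>UNIV. M $ i $ j * (w $ j * cnj (w $ i) * gaussian (\<lambda>_. 0) w))
      (\<Sum>i\<in>UNIV. \<Sum>j\<in>UNIV. M $ i $ j * (if j = i then 1 / 2 ^ CARD('n) else 0))"
    by (intro has_bochner_integral_sum has_bochner_integral_mult_right moments(5))
  moreover have "(\<Sum>i\<in>UNIV. \<Sum>j\<in>UNIV. M $ i $ j * (if j = i then 1 / 2 ^ CARD('n) else 0)) = trace M / 2 ^ CARD('n)"
    by (simp add: trace_def if_distrib sum_divide_distrib cong: if_cong)
  ultimately show "has_bochner_integral mu (\<lambda>w. bil (cnj_vec w) (M *v w) * gaussian (\<lambda>_. 0) w) (trace M / 2 ^ CARD('n))"
    by (simp add: bil_matrix_vector_mult cnj_nth sum_distrib_right mult.assoc mult.left_commute [of "cnj _"])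
qed

lemma weyl_symbol_fock_quadratic:
  fixes z :: "complex^'n::finite"
  assumes T: "\<And>z w. op_kernel T z w = d_metaplectic_kernel P Q z (cnj_vec w)"
  shows "weyl_symbol_fock T z = (bil z (map_matrix cnj Q *v z) - 2 * bil (cnj_vec z) (P *v z)
    - bil (cnj_vec z) (Q *v cnj_vec z)) / 4" (is "_ = ?\<kappa> / 4")
proof -
  let ?C = "map_matrix cnj Q" and ?u = "cnj_vec z"
  let ?g = "gaussian (\<lambda>_ :: complex^'n. 0)"
  \<comment> \<open>a and b collect the coefficients of w and of its conjugate in the expanded
    polynomial; these linear terms integrate to 0.\<close>
  define a where "a = transpose ?C *v z + ?C *v z - 2 *s (transpose P *v ?u)"
  define b where "b = 2 *s (P *v z) + transpose Q *v ?u + Q *v ?u"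
  have cnj_diff: "cnj_vec (z - w) = ?u - cnj_vec w" for w
    by (simp add: cnj_vec_def vec_eq_iff)
  have integrand: "op_kernel T (z + w) (z - w) *
      exp ((- bil z (cnj_vec z) - bil w (cnj_vec w) + bil z (cnj_vec w) - bil (cnj_vec z) w) / 2) =
    (?\<kappa> / 4 - trace P / 2) * ?g w + 1 / 4 * (bil a w * ?g w) + 1 / 4 * (bil b (cnj_vec w) * ?g w) +
      1 / 4 * (bil w (?C *v w) * ?g w) + 1 / 2 * (bil (cnj_vec w) (P *v w) * ?g w) +
      - 1 / 4 * (bil (cnj_vec w) (Q *v cnj_vec w) * ?g w)" for w
  proof -
    have "bil (z + w) (?u - cnj_vec w) / 2 + (- bil z (cnj_vec z) - bil w (cnj_vec w) + bil z (cnj_vec w)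
        - bil (cnj_vec z) w) / 2 = - bil w (cnj_vec w)"
      by (simp add: bil_simps bil_commute [of "cnj_vec z" w] field_simps)
    then have g: "exp (bil (z + w) (?u - cnj_vec w) / 2) * exp ((- bil z (cnj_vec z) - bil w (cnj_vec w) +
        bil z (cnj_vec w) - bil (cnj_vec z) w) / 2) = ?g w"
      by (simp only: exp_add [symmetric] gaussian_0_complex)
    \<comment> \<open>The second argument enters as z - w, which turns the mixed term - 2/4 into +
      1/2; its integral can therefore offset the trace.\<close>
    have poly: "- trace P / 2 + (bil (z + w) (?C *v (z + w)) - 2 * bil (?u - cnj_vec w) (P *v (z + w))
        - bil (?u - cnj_vec w) (Q *v (?u - cnj_vec w))) / 4 =
      ?\<kappa> / 4 - trace P / 2 + 1 / 4 * bil a w + 1 / 4 * bil b (cnj_vec w) + 1 / 4 * bil w (?C *v w) +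
      1 / 2 * bil (cnj_vec w) (P *v w) + - 1 / 4 * bil (cnj_vec w) (Q *v cnj_vec w)"
      by (simp add: a_def b_def matrix_vector_right_distrib matrix_vector_mult_diff_distrib bil_simps
          bil_transpose [symmetric] bil_commute [of w] bil_commute [of "cnj_vec w"] field_simps
          del: transpose_matrix_vector)
    show ?thesis
      unfolding T d_metaplectic_kernel_def cnj_diff mult.assoc g poly
      by (simp only: distrib_right mult.assoc)
  qed
  have "has_bochner_integral mu (\<lambda>w. op_kernel T (z + w) (z - w) *
      exp ((- bil z (cnj_vec z) - bil w (cnj_vec w) + bil z (cnj_vec w) - bil (cnj_vec z) w) / 2))
    ((?\<kappa> / 4 - trace P / 2) * (1 / 2 ^ CARD('n)) + 1 / 4 * 0 + 1 / 4 * 0 + 1 / 4 * 0 +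
      1 / 2 * (trace P / 2 ^ CARD('n)) + - 1 / 4 * 0)"
    unfolding integrand
    by (intro has_bochner_integral_add has_bochner_integral_mult_right has_bochner_integral_mu_gaussian
        has_bochner_integral_mu_forms)
  then have weyl: "weyl_symbol_fock T z = 2 ^ CARD('n) * ((?\<kappa> / 4 - trace P / 2) * (1 / 2 ^ CARD('n)) +
      1 / 4 * 0 + 1 / 4 * 0 + 1 / 4 * 0 + 1 / 2 * (trace P / 2 ^ CARD('n)) + - 1 / 4 * 0)"
    unfolding weyl_symbol_fock_def by (simp only: has_bochner_integral_iff)
  \<comment> \<open>With N = 2^n this is the final cancellation: the mean of the mixed term is p /
    N, and half of it removes - p / 2.\<close>
  have "N * ((k / 4 - p / 2) * (1 / N) + 1 / 4 * 0 + 1 / 4 * 0 + 1 / 4 * 0 + 1 / 2 * (p / N) + - 1 / 4 * 0) = k / 4"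
    if "N \<noteq> 0" for N k p :: complex
    using that by (simp add: field_simps)
  from this [of "2 ^ CARD('n)"] show ?thesis
    unfolding weyl by simp
qed

section \<open>The upper blocks of the conjugate of X by U, and the real quadratic form\<close>

lemma matrix_inv_eqI:
  assumes "M ** N = mat 1" "N ** M = mat 1"
  shows "matrix_inv M = N"
proof -
  have "\<exists>N. M ** N = mat 1 \<and> N ** M = mat 1"
    using assms by blast
  then have inv: "matrix_inv M ** M = mat 1"
    unfolding matrix_inv_def by (rule someI2_ex) simp
  have "matrix_inv M = matrix_inv M ** (M ** N)"
    using assms by simp
  also have "\<dots> = N"
    by (simp add: matrix_mul_assoc inv)
  finally show ?thesis .
qed

lemma mat_mult_left_nth: "(mat c ** M) $ i $ j = c * (M $ i $ j :: complex)"
  by (simp add: matrix_matrix_mult_def mat_def if_distrib [of "\<lambda>c. c * _"] cong: if_cong)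

lemma mat_mult_right_nth: "(M ** mat c) $ i $ j = (M $ i $ j :: complex) * c"
  by (simp add: matrix_matrix_mult_def mat_def if_distrib cong: if_cong)

lemma block_mat_mat_1: "block_mat (mat 1) 0 0 (mat 1) = (mat 1 :: complex^('n::finite + 'n)^('n + 'n))"
  by (auto simp: vec_eq_iff block_mat_def mat_def split: sum.split)

lemma matrix_inv_U_mat:
  "matrix_inv (U_mat :: complex^('n::finite + 'n)^('n + 'n)) =
    block_mat (mat (1 / 2)) (mat (1 / 2)) (mat (- \<i> / 2)) (mat (\<i> / 2))"
proof (rule matrix_inv_eqI)
  have U: "U_mat = (block_mat (mat 1) (mat \<i>) (mat 1) (mat (- \<i>)) :: complex^('n + 'n)^('n + 'n))"
    by (simp add: U_mat_def vec_eq_iff block_mat_def mat_def split: sum.split)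
  have mat: "mat a ** mat b = (mat (a * b) :: complex^'n^'n)" "mat a + mat b = (mat (a + b) :: complex^'n^'n)"
    "mat 0 = (0 :: complex^'n^'n)" for a b
    by (simp_all add: vec_eq_iff mat_mult_left_nth) (simp_all add: mat_def)
  show "U_mat ** block_mat (mat (1 / 2)) (mat (1 / 2)) (mat (- \<i> / 2)) (mat (\<i> / 2)) =
      (mat 1 :: complex^('n + 'n)^('n + 'n))"
    unfolding U block_mat_mult mat by (simp add: mat block_mat_mat_1)
  show "block_mat (mat (1 / 2)) (mat (1 / 2)) (mat (- \<i> / 2)) (mat (\<i> / 2)) ** U_mat =
      (mat 1 :: complex^('n + 'n)^('n + 'n))"
    unfolding U block_mat_mult mat by (simp add: mat block_mat_mat_1)
qed

lemma upper_blocks: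
  fixes A B C D :: "real^'n::finite^'n"
  defines "Y \<equiv> U_mat ** map_matrix complex_of_real (block_mat A B C D) ** matrix_inv U_mat"
  shows "upper_left Y $ i $ j = (complex_of_real (A $ i $ j + D $ i $ j) + \<i> * complex_of_real (C $ i $ j - B $ i $ j)) / 2"
    and "upper_right Y $ i $ j = (complex_of_real (A $ i $ j - D $ i $ j) + \<i> * complex_of_real (C $ i $ j + B $ i $ j)) / 2"
proof -
  let ?c = "map_matrix complex_of_real :: real^'n^'n \<Rightarrow> complex^'n^'n"
  have "map_matrix complex_of_real (block_mat A B C D) = block_mat (?c A) (?c B) (?c C) (?c D)"
    by (simp add: vec_eq_iff block_mat_def map_matrix_def split: sum.split)
  then have Y: "Y = block_mat (mat 1) (mat \<i>) (mat 1) (- mat \<i>) ** block_mat (?c A) (?c B) (?c C) (?c D) **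
      block_mat (mat (1 / 2)) (mat (1 / 2)) (mat (- \<i> / 2)) (mat (\<i> / 2))"
    by (simp add: Y_def matrix_inv_U_mat) (simp add: U_mat_def)
  have upper: "upper_left (block_mat a b c d) = a" "upper_right (block_mat a b c d) = b"
    for a b c d :: "complex^'n^'n"
    by (simp_all add: upper_left_def upper_right_def block_mat_def vec_eq_iff)
  show "upper_left Y $ i $ j = (complex_of_real (A $ i $ j + D $ i $ j) + \<i> * complex_of_real (C $ i $ j - B $ i $ j)) / 2"
    unfolding Y block_mat_mult upper
    by (simp add: mat_mult_left_nth mat_mult_right_nth map_matrix_def field_simps)
  show "upper_right Y $ i $ j = (complex_of_real (A $ i $ j - D $ i $ j) + \<i> * complex_of_real (C $ i $ j + B $ i $ j)) / 2"
    unfolding Y block_mat_mult upper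
    by (simp add: mat_mult_left_nth mat_mult_right_nth map_matrix_def field_simps)
qed

text \<open>Expresses the complex blocks through real bilinear forms, where the transpose of A
  appears as \<open>\<beta> A\<close> with exchanged arguments.\<close>

lemma bil_upper_blocks:
  fixes A B C :: "real^'n::finite^'n" and u v :: "complex^'n"
  defines "Y \<equiv> U_mat ** map_matrix complex_of_real (block_mat A B C (- transpose A)) ** matrix_inv U_mat"
  defines "\<beta> \<equiv> \<lambda>(M :: real^'n^'n) u v. bil u (map_matrix complex_of_real M *v v)"
  shows "bil u (upper_left Y *v v) = (\<beta> A u v - \<beta> A v u + \<i> * (\<beta> C u v - \<beta> B u v)) / 2"
    and "bil u (upper_right Y *v v) = (\<beta> A u v + \<beta> A v u + \<i> * (\<beta> C u v + \<beta> B u v)) / 2"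
    and "bil u (map_matrix cnj (upper_right Y) *v v) = (\<beta> A u v + \<beta> A v u - \<i> * (\<beta> C u v + \<beta> B u v)) / 2"
proof -
  have tr: "\<beta> A v u = (\<Sum>i\<in>UNIV. \<Sum>j\<in>UNIV. complex_of_real (A $ j $ i) * (u $ i * v $ j))"
    unfolding \<beta>_def bil_matrix_vector_mult
    by (subst sum.swap) (simp add: map_matrix_def mult_ac)
  have \<beta>: "\<beta> M u v = (\<Sum>i\<in>UNIV. \<Sum>j\<in>UNIV. complex_of_real (M $ i $ j) * (u $ i * v $ j))" for M
    unfolding \<beta>_def bil_matrix_vector_mult by (simp add: map_matrix_def)
  note blocks = upper_blocks [of A B C "- transpose A", folded Y_def]
  show "bil u (upper_left Y *v v) = (\<beta> A u v - \<beta> A v u + \<i> * (\<beta> C u v - \<beta> B u v)) / 2"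
    unfolding bil_matrix_vector_mult tr \<beta> blocks
    by (simp add: transpose_def sum_subtractf [symmetric] sum.distrib [symmetric] sum_distrib_left
        sum_divide_distrib algebra_simps add_divide_distrib diff_divide_distrib)
  show "bil u (upper_right Y *v v) = (\<beta> A u v + \<beta> A v u + \<i> * (\<beta> C u v + \<beta> B u v)) / 2"
    unfolding bil_matrix_vector_mult tr \<beta> blocks
    by (simp add: transpose_def sum_subtractf [symmetric] sum.distrib [symmetric] sum_distrib_left
        sum_divide_distrib algebra_simps add_divide_distrib diff_divide_distrib)
  have cnj: "map_matrix cnj (upper_right Y) $ i $ j = (complex_of_real (A $ i $ j - (- transpose A) $ i $ j)
      - \<i> * complex_of_real (C $ i $ j + B $ i $ j)) / 2" for i j
    by (simp add: map_matrix_def blocks)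
  show "bil u (map_matrix cnj (upper_right Y) *v v) = (\<beta> A u v + \<beta> A v u - \<i> * (\<beta> C u v + \<beta> B u v)) / 2"
    unfolding bil_matrix_vector_mult tr \<beta> cnj
    by (simp add: transpose_def sum_subtractf [symmetric] sum.distrib [symmetric] sum_distrib_left
        sum_divide_distrib algebra_simps add_divide_distrib diff_divide_distrib)
qed

lemma block_mat_join_vec:
  fixes A B C D :: "real^'n::finite^'n"
  shows "block_mat A B C D *v join_vec x y = join_vec (A *v x + B *v y) (C *v x + D *v y)"
  by (simp add: vec_eq_iff block_mat_def join_vec_def matrix_vector_mult_def sum_UNIV_Plus split: sum.split)

lemma inner_join_vec: "join_vec x y \<bullet> join_vec x' y' = x \<bullet> x' + y \<bullet> (y' :: real^'n::finite)"
  by (simp add: inner_vec_def join_vec_def sum_UNIV_Plus)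

text \<open>\<open>J_mat\<close> exchanges the two components of X applied to (x, y), with a sign.
  The two terms containing A agree by transposition, which produces the factor 2.\<close>

lemma inner_join_vec_J:
  fixes A B C :: "real^'n::finite^'n"
  shows "join_vec x y \<bullet> ((J_mat ** block_mat A B C (- transpose A)) *v join_vec x y) =
    - (2 * (y \<bullet> (A *v x)) + y \<bullet> (B *v y) - x \<bullet> (C *v x))"
proof -
  have neg: "(- M) *v v = - (M *v v)" for M :: "real^'n^'n" and v
    by (simp add: vec_eq_iff matrix_vector_mult_def sum_negf)
  have "x \<bullet> (transpose A *v y) = y \<bullet> (A *v x)"
    by (metis dot_lmul_matrix inner_commute transpose_matrix_vector)
  then show ?thesis
    by (simp add: matrix_vector_mul_assoc [symmetric] J_mat_def block_mat_join_vec inner_join_vec neg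
        inner_add_right algebra_simps)
qed

theorem proposition8p3:
  fixes A B C :: "real^'n::finite^'n"
    and X :: "real^('n + 'n)^('n + 'n)"
    and x y :: "real^'n"
  assumes "X = block_mat A B C (- transpose A)"
    and "X \<in> sp_algebra"
  shows "weyl_symbol (d_metaplectic' X) x y =
      1 / 2 * \<i> * complex_of_real (2 * (y \<bullet> (A *v x)) + y \<bullet> (B *v y) - x \<bullet> (C *v x)) \<and>
    1 / 2 * \<i> * complex_of_real (2 * (y \<bullet> (A *v x)) + y \<bullet> (B *v y) - x \<bullet> (C *v x)) =
      - (1 / 2) * \<i> * complex_of_real (join_vec x y \<bullet> ((J_mat ** X) *v join_vec x y))"
proof
  define z where "z = cvec x + \<i> *s cvec y"
  have cnj_z: "cnj_vec z = cvec x - \<i> *s cvec y"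
    by (simp add: z_def cnj_vec_def cvec_def vec_eq_iff)
  define \<beta> where "\<beta> M u v = bil u (map_matrix complex_of_real M *v v)" for M :: "real^'n^'n" and u v
  have real: "\<beta> M (cvec p) (cvec q) = complex_of_real (p \<bullet> (M *v q))" for M and p q :: "real^'n"
    by (simp add: \<beta>_def bil_def cvec_def map_matrix_def matrix_vector_mult_def inner_vec_def)
  have sym: "transpose B = B" "transpose C = C"
    using assms by (simp_all add: block_mat_in_sp_algebra_iff)
  have swap: "x \<bullet> (M *v y) = y \<bullet> (M *v x)" if "transpose M = M" for M
    using that by (metis dot_lmul_matrix inner_commute transpose_matrix_vector)
  have lin: "\<beta> M (p + r *s q) (p' + r' *s q') =
      \<beta> M p p' + r' * \<beta> M p q' + r * \<beta> M q p' + r * r' * \<beta> M q q'" for M p q p' q' r r'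
    by (simp add: \<beta>_def bil_simps matrix_vector_right_distrib vector_scalar_commute algebra_simps)
  \<comment> \<open>Written as a sum so that \<open>lin\<close> applies to z and to its conjugate,
    with coefficients i and - i.\<close>
  have minus: "cvec x - \<i> *s cvec y = cvec x + (- \<i>) *s cvec y"
    by (simp add: vec_eq_iff)
  have "weyl_symbol (d_metaplectic' X) x y =
      (bil z (map_matrix cnj (upper_right (U_mat ** map_matrix complex_of_real X ** matrix_inv U_mat)) *v z)
       - 2 * bil (cnj_vec z) (upper_left (U_mat ** map_matrix complex_of_real X ** matrix_inv U_mat) *v z)
       - bil (cnj_vec z) (upper_right (U_mat ** map_matrix complex_of_real X ** matrix_inv U_mat) *v cnj_vec z)) / 4"
    unfolding weyl_symbol_def z_def [symmetric]
    by (rule weyl_symbol_fock_quadratic) (rule op_kernel_d_metaplectic')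
  \<comment> \<open>For A, the mixed term with the block P cancels \<open>\<beta> A\<close> at (x,
    y) and doubles it at (y, x). For B and C, the pure terms give differences of the values at x and
    y and the mixed term gives sums, with opposite signs for B and C; so y survives for B and x for
    C. Symmetry removes their cross terms.\<close>
  also have "\<dots> = 1 / 2 * \<i> * complex_of_real (2 * (y \<bullet> (A *v x)) + y \<bullet> (B *v y) - x \<bullet> (C *v x))"
    unfolding assms(1) bil_upper_blocks \<beta>_def [symmetric] cnj_z minus
    unfolding z_def lin real
    using swap [OF sym(1)] swap [OF sym(2)]
    by (simp add: field_simps)
  finally show "weyl_symbol (d_metaplectic' X) x y =
      1 / 2 * \<i> * complex_of_real (2 * (y \<bullet> (A *v x)) + y \<bullet> (B *v y) - x \<bullet> (C *v x))" .
  show "1 / 2 * \<i> * complex_of_real (2 * (y \<bullet> (A *v x)) + y \<bullet> (B *v y) - x \<bullet> (C *v x)) =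
      - (1 / 2) * \<i> * complex_of_real (join_vec x y \<bullet> ((J_mat ** X) *v join_vec x y))"
    unfolding assms(1) inner_join_vec_J by (simp add: algebra_simps)
qed

end
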